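(* Let $\{f_n\}_{n\ge 1}$ be a sequence of real numbers with $f_n \ge n$ for all $n$. For each $n$, consider an $n\times n$ input-queued switch, starting empty, in which the arrival processes to the $n^2$ queues are independent Bernoulli processes with common rate $\rho/n$ per time slot, where $\rho = 1 - 1/f_n$. Then there is a constant $c$, not depending on $n$, such that for every $n$ there exists a scheduling policy under which $$\sum_{i,j=1}^n \mathbb{E}[Q_{i,j}(\tau)] \le c\, n^{1.5} f_n \log f_n \qquad \text{for all } \tau\in\{1,2,\dots\}.$$
   Context: **Input-queued switch.** An $n\times n$ input-queued switch operates in discrete time slots $\tau\in\{1,2,\dots\}$ and has one queue for each pair $(i,j)$, $1\le i,j\le n$ (packets at input port $i$ destined for output port $j$). $A_{i,j}(\tau)$ is the cumulative number of packets arriving to queue $(i,j)$ during slots $1,\dots,\tau$, with $A_{i,j}(0)=0$. The processes $A_{i,j}(\cdot)$ are independent across $(i,j)$, and for each $(i,j)$ the increments $A_{i,j}(\tau)-A_{i,j}(\tau-1)$, $\tau\ge 1$, are i.i.d. Bernoulli with parameter $\rho/n$. **Schedules and policies.** The set of feasible schedules is $$\mathcal S=\Big\{\sigma\in\{0,1\}^{n\times n}: \sum_k\sigma_{i,k}\le 1,\ \sum_k\sigma_{k,j}\le 1\ \text{ for all } i,j\Big\}.$$ A scheduling policy is a rule that at each time $\tau$ chooses a schedule $\sigma(\tau)\in\mathcal S$ based on the past history and the current queue sizes $Q_{i,j}(\tau)$. The policy may depend on $n$ and $\rho$. **Dynamics.** $Q_{i,j}(\tau)$ is the number of packets in queue $(i,j)$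 at the beginning of slot $\tau$. The system starts empty, $Q_{i,j}(1)=0$ for all $i,j$, and service precedes the arrivals of the slot: $$Q_{i,j}(\tau+1)=Q_{i,j}(\tau)-\sigma_{i,j}(\tau)\mathbf 1_{\{Q_{i,j}(\tau)>0\}}+A_{i,j}(\tau)-A_{i,j}(\tau-1).$$ $\log$ is the natural logarithm. *)

theory Defs
  imports "HOL-Probability.Probability"
begin

text \<open>
  The ports of the switch are numbered \<open>1..n\<close>. An \<open>n \<times> n\<close> matrix is a function on pairs of
  numbers that is \<open>0\<close> outside the ports.
\<close>

type_synonym nmat = "nat \<Rightarrow> nat \<Rightarrow> nat"

definition schedules :: "nat \<Rightarrow> nmat set" where
  "schedules n = {\<sigma>.
     (\<forall>i j. \<sigma> i j \<in> {0, 1}) \<and>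
     (\<forall>i j. i \<notin> {1..n} \<or> j \<notin> {1..n} \<longrightarrow> \<sigma> i j = 0) \<and>
     (\<forall>i\<in>{1..n}. (\<Sum>k=1..n. \<sigma> i k) \<le> 1) \<and>
     (\<forall>j\<in>{1..n}. (\<Sum>k=1..n. \<sigma> k j) \<le> 1)}"

text \<open>
  The past history at the beginning of slot \<open>\<tau>\<close> is the list of the \<open>\<tau> - 1\<close> triples (queue sizes at
  the beginning of the slot, schedule used, arrivals during the slot), oldest slot first. In
  particular \<open>\<tau>\<close> itself can be read off as the length of the list plus one, and the arrivals of
  slot \<open>\<tau>\<close> are not available to the policy.
\<close>

type_synonym history = "(nmat \<times> nmat \<times> nmat) list"
type_synonym policy = "history \<Rightarrow> nmat \<Rightarrow> nmat"

definition scheduling_policy :: "nat \<Rightarrow> policy \<Rightarrow> bool" where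
  "scheduling_policy n \<pi> \<longleftrightarrow> (\<forall>h q. \<pi> h q \<in> schedules n)"

definition slot_arrivals :: "nat \<Rightarrow> (nat \<Rightarrow> nat \<Rightarrow> nat \<Rightarrow> nat) \<Rightarrow> nat \<Rightarrow> nmat" where
  "slot_arrivals n A \<tau> i j = (if i \<in> {1..n} \<and> j \<in> {1..n} then A i j \<tau> - A i j (\<tau> - 1) else 0)"

text \<open>
  Past history and queue sizes at the beginning of slot \<open>t + 1\<close>, for one path of the
  cumulative arrivals \<open>A i j \<tau>\<close>.
\<close>

primrec switch_state ::
  "nat \<Rightarrow> policy \<Rightarrow> (nat \<Rightarrow> nat \<Rightarrow> nat \<Rightarrow> nat) \<Rightarrow> nat \<Rightarrow> history \<times> nmat" where
  "switch_state n \<pi> A 0 = ([], \<lambda>i j. 0)"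
| "switch_state n \<pi> A (Suc t) =
     (let (h, q) = switch_state n \<pi> A t;
          \<sigma> = \<pi> h q;
          a = slot_arrivals n A (Suc t)
      in (h @ [(q, \<sigma>, a)], \<lambda>i j. q i j - \<sigma> i j * of_bool (q i j > 0) + a i j))"

definition past_history :: "nat \<Rightarrow> policy \<Rightarrow> (nat \<Rightarrow> nat \<Rightarrow> nat \<Rightarrow> nat) \<Rightarrow> nat \<Rightarrow> history" where
  "past_history n \<pi> A \<tau> = fst (switch_state n \<pi> A (\<tau> - 1))"

definition queue :: "nat \<Rightarrow> policy \<Rightarrow> (nat \<Rightarrow> nat \<Rightarrow> nat \<Rightarrow> nat) \<Rightarrow> nat \<Rightarrow> nmat" where
  "queue n \<pi> A \<tau> = snd (switch_state n \<pi> A (\<tau> - 1))"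

definition schedule_at :: "nat \<Rightarrow> policy \<Rightarrow> (nat \<Rightarrow> nat \<Rightarrow> nat \<Rightarrow> nat) \<Rightarrow> nat \<Rightarrow> nmat" where
  "schedule_at n \<pi> A \<tau> = \<pi> (past_history n \<pi> A \<tau>) (queue n \<pi> A \<tau>)"

lemma queue_initial: "queue n \<pi> A 1 i j = 0"
  by (simp add: queue_def)

lemma past_history_initial: "past_history n \<pi> A 1 = []"
  by (simp add: past_history_def)

lemma past_history_step:
  assumes "\<tau> \<ge> 1"
  shows "past_history n \<pi> A (\<tau> + 1) =
    past_history n \<pi> A \<tau> @ [(queue n \<pi> A \<tau>, schedule_at n \<pi> A \<tau>, slot_arrivals n A \<tau>)]"
  using assms
  by (cases \<tau>) (simp_all add: past_history_def queue_def schedule_at_def Let_def split_beta)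

lemma queue_step:
  assumes "\<tau> \<ge> 1" "i \<in> {1..n}" "j \<in> {1..n}" "A i j (\<tau> - 1) \<le> A i j \<tau>"
  shows "queue n \<pi> A (\<tau> + 1) i j =
    queue n \<pi> A \<tau> i j - schedule_at n \<pi> A \<tau> i j * of_bool (queue n \<pi> A \<tau> i j > 0)
    + A i j \<tau> - A i j (\<tau> - 1)"
  using assms
  by (cases \<tau>)
    (simp_all add: past_history_def queue_def schedule_at_def slot_arrivals_def Let_def split_beta)

text \<open>
  Cumulative counts are monotone, so the subtraction of natural numbers in the increments never
  truncates. Independence across queues is independence of the whole processes, as random
  elements of the sequence space.
\<close>

definition bernoulli_arrivals ::
  "nat \<Rightarrow> real \<Rightarrow> 'a measure \<Rightarrow> (nat \<Rightarrow> nat \<Rightarrow> nat \<Rightarrow> 'a \<Rightarrow> nat) \<Rightarrow> bool" where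
  "bernoulli_arrivals n \<rho> M A \<longleftrightarrow>
     prob_space M \<and>
     (\<forall>i\<in>{1..n}. \<forall>j\<in>{1..n}. \<forall>\<omega>\<in>space M. A i j 0 \<omega> = 0 \<and> mono (\<lambda>\<tau>. A i j \<tau> \<omega>)) \<and>
     prob_space.indep_vars M (\<lambda>_. \<Pi>\<^sub>M \<tau>\<in>UNIV. count_space UNIV)
       (\<lambda>(i, j) \<omega>. \<lambda>\<tau>. A i j \<tau> \<omega>) ({1..n} \<times> {1..n}) \<and>
     (\<forall>i\<in>{1..n}. \<forall>j\<in>{1..n}.
        prob_space.indep_vars M (\<lambda>_. count_space UNIV)
          (\<lambda>\<tau> \<omega>. A i j \<tau> \<omega> - A i j (\<tau> - 1) \<omega>) {1..} \<and>
        (\<forall>\<tau>\<ge>1. distr M (count_space UNIV) (\<lambda>\<omega>. A i j \<tau> \<omega> - A i j (\<tau> - 1) \<omega>) =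
           measure_pmf (map_pmf of_bool (bernoulli_pmf (\<rho> / real n)))))"

end

theory Submission
  imports Defs
begin

text \<open>
  Arrivals are grouped into batches of \<open>b \<approx> 640 f\<^sup>2 ln f\<close> slots. With high probability
  every port receives at most \<open>b - n\<close> packets of a batch, the slack \<open>b / f \<approx> 640 f ln f\<close> of the
  mean being a large multiple of the standard deviation \<open>\<surd>b\<close>. The service of a batch starts
  only \<open>d \<approx> 5120 \<surd>n f ln f\<close> slots after its first arrival. This delay puts \<open>d / n\<close>
  packets in front of every queue, more than the fluctuations \<open>\<surd>(b / n)\<close> of its arrivals, so
  that a round-robin schedule wastes no service while the batch is still arriving. At the end of the
  batch each port has at most \<open>d - n\<close> packets left, which by Koenig's edge colouring theorem are
  cleared in \<open>d - n\<close> slots. Hence about \<open>n d\<close> packets of a batch are waiting at any time, which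
  gives the order \<open>n\<^sup>1\<^sup>.\<^sup>5 f ln f\<close>.

  A batch fails with probability at most \<open>p\<close>, of order \<open>f\<^sup>-\<^sup>3\<^sup>5\<close>. The packets it leaves
  behind are bounded, queue by queue, by a process \<open>V\<close> that grows by \<open>b\<close> at a failure and
  otherwise decreases by one in the last \<open>n\<close> slots of a frame. The exponential moment
  \<open>E (1 + 1/b)\<^sup>V\<close> stays below \<open>1 + 12 p b\<close>, hence \<open>E V\<close> is at most \<open>12 p b\<^sup>2\<close>, which
  is negligible.
\<close>

subsection \<open>Matchings and edge colourings\<close>

text \<open>Induction on the size of the index set. If some proper nonempty subfamily
  \<open>J\<close> is tight, \<open>J\<close> and its complement are matched separately. Otherwise
  every proper nonempty subfamily has an element to spare, so an arbitrary choice for one index can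
  be fixed and removed.\<close>

lemma hall_marriage:
  fixes N :: "'a \<Rightarrow> 'b set"
  assumes "finite I" "\<And>i. i \<in> I \<Longrightarrow> finite (N i)"
    and "\<And>J. J \<subseteq> I \<Longrightarrow> card J \<le> card (\<Union>(N ` J))"
  shows "\<exists>g. inj_on g I \<and> (\<forall>i\<in>I. g i \<in> N i)"
  using assms
proof (induction "card I" arbitrary: I N rule: less_induct)
  case less
  note fin = less.prems(1) and finN = less.prems(2) and hall = less.prems(3)
  show ?case
  proof (cases "I = {}")
    case False
    then obtain i where i: "i \<in> I" by blast
    show ?thesis
    proof (cases "\<exists>J. J \<subseteq> I \<and> J \<noteq> {} \<and> J \<noteq> I \<and> card (\<Union>(N ` J)) = card J")
      case True
      then obtain J where J: "J \<subseteq> I" "J \<noteq> {}" "J \<noteq> I" "card (\<Union>(N ` J)) = card J" by blast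
      have finJ: "finite J" using J fin finite_subset by blast
      have finUJ: "finite (\<Union>(N ` J))" using finJ finN J by blast
      have "card J < card I" using J fin by (simp add: psubsetI psubset_card_mono)
      then obtain g1 where g1: "inj_on g1 J" "\<forall>i\<in>J. g1 i \<in> N i"
        using less.hyps[of J N, OF _ finJ finN hall] J(1) by auto
      \<comment> \<open>Removing the elements used by the tight \<open>J\<close> preserves Hall's
        condition on \<open>I - J\<close>: apply it to \<open>K \<union> J\<close> and cancel the
        \<open>card J\<close> elements belonging to \<open>J\<close>.\<close>
      define N' where "N' = (\<lambda>i. N i - \<Union>(N ` J))"
      have "card K \<le> card (\<Union>(N' ` K))" if K: "K \<subseteq> I - J" for K
      proof -
        have finK: "finite K" using K fin finite_subset by blast
        have "card (K \<union> J) = card K + card J"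
          using K finK finJ by (intro card_Un_disjoint) auto
        moreover have "card (K \<union> J) \<le> card (\<Union>(N ` (K \<union> J)))"
          using K J by (intro hall) auto
        moreover have "\<Union>(N ` (K \<union> J)) = \<Union>(N' ` K) \<union> \<Union>(N ` J)"
          by (auto simp: N'_def)
        moreover have "card (\<Union>(N' ` K) \<union> \<Union>(N ` J)) \<le> card (\<Union>(N' ` K)) + card (\<Union>(N ` J))"
          by (rule card_Un_le)
        ultimately show ?thesis using J(4) by simp
      qed
      moreover have "card (I - J) < card I" using J fin by (intro psubset_card_mono) auto
      ultimately obtain g2 where g2: "inj_on g2 (I - J)" "\<forall>i\<in>I - J. g2 i \<in> N' i"
        using less.hyps[of "I - J" N'] fin finN by (auto simp: N'_def)
      define g where "g = (\<lambda>i. if i \<in> J then g1 i else g2 i)"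
      have sep: "g1 x \<noteq> g2 y" if "x \<in> J" "y \<in> I - J" for x y
        using g1(2) g2(2) that by (force simp: N'_def)
      have "inj_on g I"
      proof (rule inj_onI)
        fix x y assume xy: "x \<in> I" "y \<in> I" "g x = g y"
        show "x = y"
        proof (cases "x \<in> J"; cases "y \<in> J")
          assume "x \<in> J" "y \<in> J"
          then show ?thesis using xy g1(1) by (auto simp: g_def dest: inj_onD)
        next
          assume "x \<notin> J" "y \<notin> J"
          then show ?thesis using xy g2(1) by (auto simp: g_def dest: inj_onD)
        next
          assume "x \<in> J" "y \<notin> J"
          then show ?thesis using xy sep[of x y] by (simp add: g_def)
        next
          assume "x \<notin> J" "y \<in> J"
          then show ?thesis using xy sep[of y x] by (simp add: g_def)
        qed
      qed
      moreover have "\<forall>i\<in>I. g i \<in> N i"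
        using g1 g2 by (auto simp: g_def N'_def)
      ultimately show ?thesis by blast
    next
      case noJ: False
      have "card {i} \<le> card (\<Union>(N ` {i}))" using i by (intro hall) auto
      then have "N i \<noteq> {}" using finN i by auto
      then obtain y where y: "y \<in> N i" by blast
      \<comment> \<open>With no tight proper subfamily, each union exceeds the size of its family by
        at least one, which pays for the loss of \<open>y\<close>.\<close>
      define N' where "N' = (\<lambda>k. N k - {y})"
      have "card K \<le> card (\<Union>(N' ` K))" if K: "K \<subseteq> I - {i}" for K
      proof (cases "K = {}")
        case False
        have finK: "finite K" using K fin finite_subset by blast
        have "K \<subseteq> I" "K \<noteq> I" using K i by auto
        then have "card K \<noteq> card (\<Union>(N ` K))" using noJ False by metis
        moreover have "card K \<le> card (\<Union>(N ` K))" using K by (intro hall) auto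
        moreover have "\<Union>(N' ` K) = \<Union>(N ` K) - {y}" by (auto simp: N'_def)
        moreover have "card (\<Union>(N ` K)) - 1 \<le> card (\<Union>(N ` K) - {y})"
          by (simp add: card_Diff_singleton_if)
        ultimately show ?thesis by simp
      qed simp
      moreover have "card (I - {i}) < card I" using i fin by (metis card_Diff1_less)
      ultimately obtain g where g: "inj_on g (I - {i})" "\<forall>k\<in>I - {i}. g k \<in> N' k"
        using less.hyps[of "I - {i}" N'] fin finN by (auto simp: N'_def)
      have "inj_on (g(i := y)) I"
        using g by (auto simp: inj_on_def N'_def)
      moreover have "\<forall>k\<in>I. (g(i := y)) k \<in> N k"
        using g y by (auto simp: N'_def)
      ultimately show ?thesis by blast
    qed
  qed simp
qed

section \<open>Decomposition of integer matrices into schedules\<close>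

definition regular_matrix :: "nat \<Rightarrow> nat \<Rightarrow> nmat \<Rightarrow> bool" where
  "regular_matrix n D R \<longleftrightarrow>
     (\<forall>i\<in>{1..n}. (\<Sum>j=1..n. R i j) = D) \<and> (\<forall>j\<in>{1..n}. (\<Sum>i=1..n. R i j) = D)"

text \<open>Double counting gives Hall's condition for the supports of the rows: the rows in
  \<open>J\<close> have total mass \<open>D * card J\<close>, all of it in columns of
  \<open>?U\<close>, which hold at most \<open>D\<close> each.\<close>

lemma regular_matrix_permutation:
  assumes R: "regular_matrix n D R" and D: "D > 0"
  shows "\<exists>g. bij_betw g {1..n} {1..n} \<and> (\<forall>i\<in>{1..n}. R i (g i) > 0)"
proof -
  define N where "N = (\<lambda>i. {j\<in>{1..n}. R i j > 0})"
  have "card J \<le> card (\<Union>(N ` J))" if J: "J \<subseteq> {1..n}" for J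
  proof -
    let ?U = "\<Union>(N ` J)"
    have finJ: "finite J" using J finite_subset by blast
    have U: "?U \<subseteq> {1..n}" by (auto simp: N_def)
    have "D * card J = (\<Sum>i\<in>J. \<Sum>j=1..n. R i j)"
      using R J by (subst sum.cong[OF refl, where h = "\<lambda>_. D"]) (auto simp: regular_matrix_def)
    also have "\<dots> = (\<Sum>i\<in>J. \<Sum>j\<in>?U. R i j)"
      using U by (intro sum.cong refl sum.mono_neutral_right) (auto simp: N_def)
    also have "\<dots> = (\<Sum>j\<in>?U. \<Sum>i\<in>J. R i j)" by (rule sum.swap)
    also have "\<dots> \<le> (\<Sum>j\<in>?U. \<Sum>i=1..n. R i j)"
      using J by (intro sum_mono sum_mono2) auto
    also have "\<dots> = D * card ?U"
      using R U by (subst sum.cong[OF refl, where h = "\<lambda>_. D"]) (auto simp: regular_matrix_def)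
    finally show ?thesis using D by simp
  qed
  then obtain g where g: "inj_on g {1..n}" "\<forall>i\<in>{1..n}. g i \<in> N i"
    using hall_marriage[of "{1..n}" N] by (auto simp: N_def)
  have "g ` {1..n} = {1..n}"
    using g by (intro card_subset_eq) (auto simp: N_def card_image)
  with g show ?thesis by (auto simp: bij_betw_def N_def)
qed

definition perm_schedule :: "nat \<Rightarrow> (nat \<Rightarrow> nat) \<Rightarrow> nmat" where
  "perm_schedule n g i j = of_bool (i \<in> {1..n} \<and> j \<in> {1..n} \<and> g i = j)"

lemma perm_schedule_row_sum:
  assumes "bij_betw g {1..n} {1..n}" "i \<in> {1..n}"
  shows "(\<Sum>j=1..n. perm_schedule n g i j) = 1"
proof -
  have "g i \<in> {1..n}" using assms bij_betwE by blast
  then show ?thesis using assms(2)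
    by (simp add: perm_schedule_def of_bool_def sum.delta if_distrib cong: if_cong)
qed

lemma perm_schedule_col_sum:
  assumes g: "bij_betw g {1..n} {1..n}" and j: "j \<in> {1..n}"
  shows "(\<Sum>i=1..n. perm_schedule n g i j) = 1"
proof -
  have "(\<Sum>i=1..n. perm_schedule n g i j) = (\<Sum>i=1..n. (\<lambda>k. of_bool (k = j)) (g i))"
    using j by (intro sum.cong) (auto simp: perm_schedule_def)
  also have "\<dots> = (\<Sum>k=1..n. of_bool (k = j))" by (rule sum.reindex_bij_betw[OF g])
  also have "\<dots> = 1" using j by (simp add: of_bool_def)
  finally show ?thesis .
qed

lemma perm_schedule_in_schedules:
  assumes "bij_betw g {1..n} {1..n}"
  shows "perm_schedule n g \<in> schedules n"
proof -
  have "perm_schedule n g i j \<in> {0, 1}" for i j by (simp add: perm_schedule_def)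
  moreover have "perm_schedule n g i j = 0" if "i \<notin> {1..n} \<or> j \<notin> {1..n}" for i j
    using that by (auto simp: perm_schedule_def)
  ultimately show ?thesis
    unfolding schedules_def
    using perm_schedule_row_sum[OF assms] perm_schedule_col_sum[OF assms] by simp
qed

text \<open>Permutations inside the support are peeled off one at a time; each lowers every row and
  column sum by exactly one.\<close>

lemma regular_matrix_decomposition:
  assumes "regular_matrix n D R"
  shows "\<exists>s. (\<forall>u. s u \<in> schedules n) \<and> (\<forall>i\<in>{1..n}. \<forall>j\<in>{1..n}. R i j = (\<Sum>u<D. s u i j))"
  using assms
proof (induction D arbitrary: R)
  case 0
  have "(\<lambda>_ _. 0) \<in> schedules n" by (auto simp: schedules_def)
  moreover have "R i j = 0" if "i \<in> {1..n}" "j \<in> {1..n}" for i j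
    using 0 that by (auto simp: regular_matrix_def)
  ultimately show ?case by (intro exI[of _ "\<lambda>_ _ _. 0"]) auto
next
  case (Suc D)
  obtain g where g: "bij_betw g {1..n} {1..n}" "\<forall>i\<in>{1..n}. R i (g i) > 0"
    using regular_matrix_permutation[OF Suc.prems] by auto
  let ?P = "perm_schedule n g"
  have le: "?P i j \<le> R i j" for i j
    using g(2) by (auto simp: perm_schedule_def of_bool_def Suc_le_eq)
  define R' where "R' = (\<lambda>i j. R i j - ?P i j)"
  have "regular_matrix n D R'"
    unfolding regular_matrix_def R'_def
    using Suc.prems perm_schedule_row_sum[OF g(1)] perm_schedule_col_sum[OF g(1)]
    by (auto simp: sum_subtractf_nat le regular_matrix_def simp del: One_nat_def)
  from Suc.IH[OF this] obtain s where s: "\<forall>u. s u \<in> schedules n"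
    "\<forall>i\<in>{1..n}. \<forall>j\<in>{1..n}. R' i j = (\<Sum>u<D. s u i j)" by blast
  define s' where "s' = s(D := ?P)"
  have "R i j = (\<Sum>u<Suc D. s' u i j)" if "i \<in> {1..n}" "j \<in> {1..n}" for i j
  proof -
    have "R i j = R' i j + ?P i j" using le[of i j] by (simp add: R'_def)
    then show ?thesis using s(2) that by (simp add: s'_def)
  qed
  moreover have "\<forall>u. s' u \<in> schedules n"
    using s(1) perm_schedule_in_schedules[OF g(1)] by (simp add: s'_def)
  ultimately show ?case by blast
qed

text \<open>Row sums and column sums have the same total, so a deficient row comes with a deficient
  column. Raising the entry where they cross reduces the total deficit and keeps all sums at most
  \<open>D\<close>.\<close>

lemma regular_matrix_padding:
  assumes "\<And>i. i \<in> {1..n} \<Longrightarrow> (\<Sum>j=1..n. R i j) \<le> D"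
    and "\<And>j. j \<in> {1..n} \<Longrightarrow> (\<Sum>i=1..n. R i j) \<le> D"
  shows "\<exists>R'. regular_matrix n D R' \<and> (\<forall>i j. R i j \<le> R' i j)"
  using assms
proof (induction "n * D - (\<Sum>i=1..n. \<Sum>j=1..n. R i j)" arbitrary: R rule: less_induct)
  case less
  note row = less.prems(1) and col = less.prems(2)
  have total: "(\<Sum>i=1..n. \<Sum>j=1..n. R i j) = (\<Sum>j=1..n. \<Sum>i=1..n. R i j)" by (rule sum.swap)
  have lt: "(\<Sum>k\<in>{1..n}. x k) < n * D"
    if "\<And>k. k \<in> {1..n} \<Longrightarrow> x k \<le> D" "l \<in> {1..n}" "x l \<noteq> D" for x :: "nat \<Rightarrow> nat" and l
  proof -
    have "(\<Sum>k\<in>{1..n}. x k) < (\<Sum>k\<in>{1..n}. D)"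
      using that by (intro sum_strict_mono_ex1) (auto simp: le_neq_implies_less intro!: bexI[of _ l])
    then show ?thesis by simp
  qed
  show ?case
  proof (cases "regular_matrix n D R")
    case False
    have "\<exists>i\<in>{1..n}. (\<Sum>j=1..n. R i j) < D"
    proof (rule ccontr)
      assume "\<not> ?thesis"
      then have eq: "\<forall>i\<in>{1..n}. (\<Sum>j=1..n. R i j) = D" using row by (meson le_neq_implies_less)
      with False obtain j where "j \<in> {1..n}" "(\<Sum>i=1..n. R i j) \<noteq> D"
        by (auto simp: regular_matrix_def)
      from lt[of "\<lambda>j. \<Sum>i=1..n. R i j", OF col this] total eq show False by simp
    qed
    then obtain i0 where i0: "i0 \<in> {1..n}" "(\<Sum>j=1..n. R i0 j) < D" by blast
    have small: "(\<Sum>i=1..n. \<Sum>j=1..n. R i j) < n * D"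
      using lt[of "\<lambda>i. \<Sum>j=1..n. R i j", OF row] i0 by simp
    have "\<exists>j\<in>{1..n}. (\<Sum>i=1..n. R i j) < D"
    proof (rule ccontr)
      assume "\<not> ?thesis"
      then have "\<forall>j\<in>{1..n}. (\<Sum>i=1..n. R i j) = D" using col by (meson le_neq_implies_less)
      then show False using small total by simp
    qed
    then obtain j0 where j0: "j0 \<in> {1..n}" "(\<Sum>i=1..n. R i j0) < D" by blast
    define R1 where "R1 = (\<lambda>i j. R i j + of_bool (i = i0) * of_bool (j = j0))"
    have r: "(\<Sum>j=1..n. R1 i j) = (\<Sum>j=1..n. R i j) + of_bool (i = i0)" for i
      using j0(1) by (simp add: R1_def sum.distrib of_bool_def)
    have c: "(\<Sum>i=1..n. R1 i j) = (\<Sum>i=1..n. R i j) + of_bool (j = j0)" for j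
      using i0(1) by (simp add: R1_def sum.distrib of_bool_def)
    have "(\<Sum>i=1..n. \<Sum>j=1..n. R1 i j) = (\<Sum>i=1..n. \<Sum>j=1..n. R i j) + 1"
      unfolding r sum.distrib using i0(1) by (simp add: of_bool_def)
    then have "n * D - (\<Sum>i=1..n. \<Sum>j=1..n. R1 i j) < n * D - (\<Sum>i=1..n. \<Sum>j=1..n. R i j)"
      using small by simp
    from less.hyps[OF this] obtain R' where "regular_matrix n D R'" "\<forall>i j. R1 i j \<le> R' i j"
      using r c row col i0(2) j0(2) by (force simp: Suc_le_eq)
    then show ?thesis by (auto simp: R1_def intro: order_trans[OF le_add1])
  qed auto
qed

text \<open>Koenig's edge colouring theorem for the bipartite multigraph with multiplicities
  \<open>R\<close>, reduced to the regular case by padding. The degree bound stands inside the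
  existential, so that feasible schedules exist for every \<open>R\<close>, including what a bad
  batch leaves.\<close>

lemma koenig_schedule_decomposition:
  "\<exists>s. (\<forall>u. s u \<in> schedules n) \<and>
     ((\<forall>i\<in>{1..n}. (\<Sum>j=1..n. R i j) \<le> D) \<and> (\<forall>j\<in>{1..n}. (\<Sum>i=1..n. R i j) \<le> D) \<longrightarrow>
       (\<forall>i\<in>{1..n}. \<forall>j\<in>{1..n}. R i j \<le> (\<Sum>u<D. s u i j)))"
proof (cases "(\<forall>i\<in>{1..n}. (\<Sum>j=1..n. R i j) \<le> D) \<and> (\<forall>j\<in>{1..n}. (\<Sum>i=1..n. R i j) \<le> D)")
  case True
  then obtain R' where R': "regular_matrix n D R'" "\<And>i j. R i j \<le> R' i j"
    using regular_matrix_padding[of n R D] by auto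
  show ?thesis using regular_matrix_decomposition[OF R'(1)] R'(2) by metis
next
  case False
  have "(\<lambda>_ _. 0) \<in> schedules n" by (auto simp: schedules_def)
  then show ?thesis using False by (intro exI[of _ "\<lambda>_ _ _. 0"]) auto
qed

subsection \<open>The batching schedule\<close>

definition rotation :: "nat \<Rightarrow> nat \<Rightarrow> nat \<Rightarrow> nat" where
  "rotation n u i = (i + u) mod n + 1"

definition round_robin :: "nat \<Rightarrow> nat \<Rightarrow> nmat" where
  "round_robin n u = perm_schedule n (rotation n u)"

lemma inj_on_mod_interval: "inj_on (\<lambda>x. x mod n) {s..<s + n :: nat}"
proof (rule inj_onI)
  have *: "x = y" if "x \<le> y" "x \<in> {s..<s + n}" "y \<in> {s..<s + n}" "x mod n = y mod n" for x y
  proof -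
    have "n dvd y - x" using that by (metis mod_eq_dvd_iff_nat)
    moreover have "y - x < n" using that by auto
    ultimately show ?thesis using that(1) by (metis nat_dvd_not_less diff_is_0_eq le_antisym not_gr0)
  qed
  fix x y assume "x \<in> {s..<s + n}" "y \<in> {s..<s + n}" "x mod n = y mod n"
  then show "x = y" using *[of x y] *[of y x] by (metis nat_le_linear)
qed

lemma bij_betw_mod_interval:
  fixes n s :: nat
  assumes "n > 0"
  shows "bij_betw (\<lambda>x. x mod n + 1) {s..<s + n} {1..n}"
proof -
  have "inj_on (\<lambda>x. x mod n + 1) {s..<s + n}"
    using inj_on_mod_interval[of n s] by (auto simp: inj_on_def)
  moreover from this have "(\<lambda>x. x mod n + 1) ` {s..<s + n} = {1..n}"
    using assms by (intro card_subset_eq) (auto simp: card_image Suc_le_eq)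
  ultimately show ?thesis by (simp add: bij_betw_def)
qed

lemma bij_betw_rotation:
  assumes "n > 0" shows "bij_betw (rotation n u) {1..n} {1..n}"
proof -
  have "bij_betw (\<lambda>i. i + u) {1..n} {Suc u..<Suc u + n}"
    by (rule bij_betwI[where g = "\<lambda>x. x - u"]) auto
  from bij_betw_trans[OF this bij_betw_mod_interval[OF assms]]
  show ?thesis by (simp add: rotation_def[abs_def] o_def)
qed

lemma round_robin_in_schedules: "n > 0 \<Longrightarrow> round_robin n u \<in> schedules n"
  unfolding round_robin_def by (intro perm_schedule_in_schedules bij_betw_rotation)

lemma round_robin_row_sum: "i \<in> {1..n} \<Longrightarrow> (\<Sum>j=1..n. round_robin n u i j) = 1"
  unfolding round_robin_def by (intro perm_schedule_row_sum bij_betw_rotation) auto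

lemma round_robin_col_sum: "j \<in> {1..n} \<Longrightarrow> (\<Sum>i=1..n. round_robin n u i j) = 1"
  unfolding round_robin_def by (intro perm_schedule_col_sum bij_betw_rotation) auto

text \<open>\<open>i + u\<close> runs through \<open>n\<close> consecutive integers and so meets
  every residue once.\<close>

lemma round_robin_cycle:
  assumes "i \<in> {1..n}" "j \<in> {1..n}"
  shows "(\<Sum>u = s..<s + n. round_robin n u i j) = 1"
proof -
  have "bij_betw (\<lambda>u. i + u) {s..<s + n} {i + s..<i + s + n}"
    by (rule bij_betwI[where g = "\<lambda>x. x - i"]) auto
  from bij_betw_trans[OF this bij_betw_mod_interval]
  have *: "bij_betw (\<lambda>u. rotation n u i) {s..<s + n} {1..n}"
    using assms by (simp add: rotation_def[abs_def] o_def)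
  have "(\<Sum>u = s..<s + n. round_robin n u i j) = (\<Sum>u = s..<s + n. (\<lambda>k. of_bool (k = j)) (rotation n u i))"
    using assms by (simp add: round_robin_def perm_schedule_def)
  also have "\<dots> = (\<Sum>k=1..n. of_bool (k = j))" by (rule sum.reindex_bij_betw[OF *])
  also have "\<dots> = 1" using assms by (simp add: of_bool_def)
  finally show ?thesis .
qed

text \<open>Every full cycle contributes one service and the incomplete cycle at most one
  more.\<close>

lemma round_robin_count_le:
  assumes "i \<in> {1..n}" "j \<in> {1..n}"
  shows "(\<Sum>u<r. round_robin n u i j) \<le> r div n + 1"
proof (induction r rule: less_induct)
  case (less r)
  show ?case
  proof (cases "r < n")
    case True
    then have "(\<Sum>u<r. round_robin n u i j) \<le> (\<Sum>u=0..<0+n. round_robin n u i j)"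
      by (intro sum_mono2) auto
    with round_robin_cycle[OF assms, of 0] show ?thesis by simp
  next
    case False
    then obtain r' where r: "r = r' + n" by (metis add.commute le_add_diff_inverse not_less)
    have "{..<r} = {..<r'} \<union> {r'..<r' + n}" using r by auto
    then have "(\<Sum>u<r. round_robin n u i j) = (\<Sum>u<r'. round_robin n u i j) + (\<Sum>u=r'..<r'+n. round_robin n u i j)"
      by (simp add: sum.union_disjoint ivl_disj_int)
    also have "\<dots> \<le> r' div n + 1 + 1"
      using less.IH[of r'] round_robin_cycle[OF assms, of r'] r assms by auto
    also have "\<dots> = r div n + 1" using r assms by auto
    finally show ?thesis .
  qed
qed

section \<open>Queue dynamics and the batch policy\<close>

definition arrivals :: "(nat \<Rightarrow> nmat) \<Rightarrow> nat \<Rightarrow> nat \<Rightarrow> nmat" where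
  "arrivals a s t i j = (\<Sum>x=s..<t. a x i j)"

text \<open>Truncated subtraction takes the place of the indicator of a nonempty queue. Index
  \<open>t\<close> refers to the beginning of slot \<open>t + 1\<close>.\<close>

primrec queues :: "(nat \<Rightarrow> nmat) \<Rightarrow> (nat \<Rightarrow> nmat) \<Rightarrow> nat \<Rightarrow> nmat" where
  "queues s a 0 = (\<lambda>i j. 0)"
| "queues s a (Suc t) = (\<lambda>i j. queues s a t i j - s t i j + a t i j)"

lemma arrivals_append: "r \<le> s \<Longrightarrow> s \<le> t \<Longrightarrow> arrivals a r t i j = arrivals a r s i j + arrivals a s t i j"
  by (simp add: arrivals_def sum.atLeastLessThan_concat)

text \<open>The offered service is credited only against the initial content, and all later arrivals
  are counted as still waiting.\<close>

lemma queues_lindley: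
  "queues s a (t + r) i j \<le> (queues s a t i j - (\<Sum>v<r. s (t + v) i j)) + arrivals a t (t + r) i j"
  by (induction r) (auto simp: arrivals_def)

text \<open>
  The arrivals of batch \<open>k\<close> are those of the steps \<open>k * b, \<dots>, k * b + b - 1\<close>, where step \<open>t\<close>
  is slot \<open>t + 1\<close>. They are served in frame \<open>k\<close>, which occupies the same steps delayed by \<open>d\<close>.
\<close>

definition remaining :: "nat \<Rightarrow> nat \<Rightarrow> nat \<Rightarrow> (nat \<Rightarrow> nmat) \<Rightarrow> nat \<Rightarrow> nmat" where
  "remaining n b d a k i j = arrivals a (k * b) (k * b + b) i j - (\<Sum>u<b - d. round_robin n u i j)"

text \<open>A fixed choice of the colouring, so that the resulting schedule is a function of the
  past.\<close>

definition clearing :: "nat \<Rightarrow> nat \<Rightarrow> nmat \<Rightarrow> nat \<Rightarrow> nmat" where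
  "clearing n D R = (SOME s. (\<forall>u. s u \<in> schedules n) \<and>
     ((\<forall>i\<in>{1..n}. (\<Sum>j=1..n. R i j) \<le> D) \<and> (\<forall>j\<in>{1..n}. (\<Sum>i=1..n. R i j) \<le> D) \<longrightarrow>
       (\<forall>i\<in>{1..n}. \<forall>j\<in>{1..n}. R i j \<le> (\<Sum>u<D. s u i j))))"

lemma clearing_in_schedules: "clearing n D R u \<in> schedules n"
  using someI_ex[OF koenig_schedule_decomposition[of n R D]] unfolding clearing_def[symmetric] by blast

lemma clearing_clears:
  assumes "\<And>i. i \<in> {1..n} \<Longrightarrow> (\<Sum>j=1..n. R i j) \<le> D"
    and "\<And>j. j \<in> {1..n} \<Longrightarrow> (\<Sum>i=1..n. R i j) \<le> D"
    and "i \<in> {1..n}" "j \<in> {1..n}"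
  shows "R i j \<le> (\<Sum>u<D. clearing n D R u i j)"
  using someI_ex[OF koenig_schedule_decomposition[of n R D]] assms unfolding clearing_def[symmetric] by blast

text \<open>
  The round-robin phase of a frame ends exactly when the arrivals of its batch do; the next
  \<open>d - n\<close> steps clear what is left of the batch, and the last \<open>n\<close> steps, which form one full
  round-robin cycle, serve one packet of earlier batches in every queue.
\<close>

definition batch_schedule :: "nat \<Rightarrow> nat \<Rightarrow> nat \<Rightarrow> (nat \<Rightarrow> nmat) \<Rightarrow> nat \<Rightarrow> nmat" where
  "batch_schedule n b d a t =
     (if t < d then \<lambda>i j. 0
      else let k = (t - d) div b; u = (t - d) mod b in
        if u < b - d then round_robin n u
        else if u < b - n then clearing n (d - n) (remaining n b d a k) (u - (b - d))
        else round_robin n u)"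

text \<open>The first clause says that the round-robin service offered to a queue through step
  \<open>u\<close> of the frame never exceeds the packets of the batch that have arrived before that
  step, so none of it is wasted. The other two bound the port loads so that, after
  \<open>b - d\<close> round-robin steps, at most \<open>d - n\<close> packets per port
  remain.\<close>

definition good_batch :: "nat \<Rightarrow> nat \<Rightarrow> nat \<Rightarrow> (nat \<Rightarrow> nmat) \<Rightarrow> nat \<Rightarrow> bool" where
  "good_batch n b d a k \<longleftrightarrow>
     (\<forall>i\<in>{1..n}. \<forall>j\<in>{1..n}. \<forall>u<b - d.
        (\<Sum>v<Suc u. round_robin n v i j) \<le> arrivals a (k * b) (k * b + d + u) i j) \<and>
     (\<forall>i\<in>{1..n}. (\<Sum>j=1..n. arrivals a (k * b) (k * b + b) i j) \<le> b - n) \<and>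
     (\<forall>j\<in>{1..n}. (\<Sum>i=1..n. arrivals a (k * b) (k * b + b) i j) \<le> b - n)"

text \<open>A bound, common to all queues, for the packets left over from earlier batches.\<close>

primrec backlog :: "nat \<Rightarrow> nat \<Rightarrow> nat \<Rightarrow> (nat \<Rightarrow> nmat) \<Rightarrow> nat \<Rightarrow> nat" where
  "backlog n b d a 0 = 0"
| "backlog n b d a (Suc k) =
     (if good_batch n b d a k then backlog n b d a k - 1 else backlog n b d a k + b)"

lemma batch_schedule_in_schedules: "n > 0 \<Longrightarrow> batch_schedule n b d a t \<in> schedules n"
  by (auto simp: batch_schedule_def Let_def round_robin_in_schedules clearing_in_schedules)
     (auto simp: schedules_def)

section \<open>Pathwise queue bounds\<close>

locale batching =
  fixes n b d :: nat and a :: "nat \<Rightarrow> nmat"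
  assumes n: "1 \<le> n" "n \<le> d" "d \<le> b" and a: "\<And>t i j. a t i j \<le> 1"
begin

abbreviation "S \<equiv> batch_schedule n b d a"
abbreviation "Q \<equiv> queues S a"
abbreviation "V \<equiv> backlog n b d a"
abbreviation "good \<equiv> good_batch n b d a"
abbreviation "T k \<equiv> k * b + d"

lemma schedule_frame:
  assumes "u < b"
  shows "S (T k + u) = (if u < b - d then round_robin n u
    else if u < b - n then clearing n (d - n) (remaining n b d a k) (u - (b - d))
    else round_robin n u)"
  using assms by (simp add: batch_schedule_def)

lemma arrivals_le: "arrivals a s t i j \<le> t - s"
proof -
  have "arrivals a s t i j \<le> (\<Sum>x=s..<t. 1)" unfolding arrivals_def by (intro sum_mono a)
  then show ?thesis by simp
qed

text \<open>The hypothesis is the invariant at the start of a frame: at most the backlog and the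
  packets of the current batch that came during the delay. The conclusion ignores all service, so it
  also covers bad batches.\<close>

lemma queue_frame_crude:
  assumes "Q (T k) i j \<le> V k + arrivals a (k * b) (T k) i j"
  shows "Q (T k + u) i j \<le> V k + arrivals a (k * b) (T k + u) i j"
  using queues_lindley[of S a "T k" u i j] assms
    arrivals_append[of "k * b" "T k" "T k + u" a i j] by simp

text \<open>If a service finds the queue empty, the truncated subtraction loses it; then the bound
  still holds because a good batch has at least as many arrivals as services offered so far.\<close>

lemma queue_round_robin_phase:
  assumes "Q (T k) i j \<le> V k + arrivals a (k * b) (T k) i j"
    and "good k" "i \<in> {1..n}" "j \<in> {1..n}" "u \<le> b - d"
  shows "Q (T k + u) i j + (\<Sum>v<u. round_robin n v i j) \<le> V k + arrivals a (k * b) (T k + u) i j"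
  using assms(5)
proof (induction u)
  case (Suc u)
  have "S (T k + u) = round_robin n u" using Suc.prems n by (simp add: schedule_frame)
  then have "Q (T k + Suc u) i j = Q (T k + u) i j - round_robin n u i j + a (T k + u) i j" by simp
  moreover have "(\<Sum>v<Suc u. round_robin n v i j) \<le> arrivals a (k * b) (T k + u) i j"
    using assms Suc.prems unfolding good_batch_def by auto
  moreover have "arrivals a (k * b) (T k + Suc u) i j = arrivals a (k * b) (T k + u) i j + a (T k + u) i j"
    by (simp add: arrivals_def)
  ultimately show ?case using Suc by simp
qed (use assms in simp)

text \<open>For a good batch the subtraction in \<open>remaining\<close> does not truncate: use the
  goodness condition at the last round-robin step, if there is one.\<close>

lemma remaining_eq:
  assumes "good k" "i \<in> {1..n}" "j \<in> {1..n}"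
  shows "remaining n b d a k i j + (\<Sum>u<b - d. round_robin n u i j) = arrivals a (k * b) (k * b + b) i j"
proof -
  have "(\<Sum>u<b - d. round_robin n u i j) \<le> arrivals a (k * b) (k * b + b) i j"
  proof (cases "b - d")
    case (Suc u)
    then have "u < b - d" by simp
    then have "(\<Sum>v<Suc u. round_robin n v i j) \<le> arrivals a (k * b) (k * b + d + u) i j"
      using assms unfolding good_batch_def by blast
    also have "\<dots> \<le> arrivals a (k * b) (k * b + b) i j"
      using arrivals_append[of "k * b" "k * b + d + u" "k * b + b" a i j] Suc by simp
    finally show ?thesis by (simp add: Suc)
  qed simp
  then show ?thesis by (simp add: remaining_def)
qed

lemma sum_round_robin:
  "i \<in> {1..n} \<Longrightarrow> (\<Sum>j=1..n. \<Sum>u<r. round_robin n u i j) = r"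
  "j \<in> {1..n} \<Longrightarrow> (\<Sum>i=1..n. \<Sum>u<r. round_robin n u i j) = r"
  by (subst sum.swap, simp add: round_robin_row_sum round_robin_col_sum del: One_nat_def)+

text \<open>Each of the \<open>b - d\<close> round-robin steps serves one packet per row, which
  lowers the load bound \<open>b - n\<close> to \<open>d - n\<close>.\<close>

lemma remaining_row_sum:
  assumes "good k" "i \<in> {1..n}"
  shows "(\<Sum>j=1..n. remaining n b d a k i j) \<le> d - n"
proof -
  have "(\<Sum>j=1..n. remaining n b d a k i j) + (b - d)
      = (\<Sum>j=1..n. remaining n b d a k i j + (\<Sum>u<b - d. round_robin n u i j))"
    using assms by (simp add: sum.distrib sum_round_robin del: One_nat_def)
  also have "\<dots> = (\<Sum>j=1..n. arrivals a (k * b) (k * b + b) i j)"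
    using assms by (intro sum.cong remaining_eq) auto
  also have "\<dots> \<le> b - n" using assms unfolding good_batch_def by blast
  finally show ?thesis using n by simp
qed

lemma remaining_col_sum:
  assumes "good k" "j \<in> {1..n}"
  shows "(\<Sum>i=1..n. remaining n b d a k i j) \<le> d - n"
proof -
  have "(\<Sum>i=1..n. remaining n b d a k i j) + (b - d)
      = (\<Sum>i=1..n. remaining n b d a k i j + (\<Sum>u<b - d. round_robin n u i j))"
    using assms by (simp add: sum.distrib sum_round_robin del: One_nat_def)
  also have "\<dots> = (\<Sum>i=1..n. arrivals a (k * b) (k * b + b) i j)"
    using assms by (intro sum.cong remaining_eq) auto
  also have "\<dots> \<le> b - n" using assms unfolding good_batch_def by blast
  finally show ?thesis using n by simp
qed

text \<open>Here \<open>v\<close> counts steps from the end of the arrivals of batch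
  \<open>k\<close>, so that all further arrivals belong to later batches.\<close>

lemma queue_clearing_phase:
  assumes "Q (T k) i j \<le> V k + arrivals a (k * b) (T k) i j"
    and "good k" "i \<in> {1..n}" "j \<in> {1..n}"
  shows "Q (k * b + b + v) i j \<le> V k + (remaining n b d a k i j - (\<Sum>x<v. S (k * b + b + x) i j))
    + arrivals a (k * b + b) (k * b + b + v) i j"
proof -
  have "T k + (b - d) = k * b + b" using n by simp
  then have "Q (k * b + b) i j \<le> V k + remaining n b d a k i j"
    using queue_round_robin_phase[OF assms order_refl] remaining_eq[OF assms(2-4)] by simp
  then show ?thesis using queues_lindley[of S a "k * b + b" v i j] by simp
qed

lemma queue_frame_end:
  assumes "Q (T k) i j \<le> V k + arrivals a (k * b) (T k) i j"
    and "good k" "i \<in> {1..n}" "j \<in> {1..n}"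
  shows "Q (T (Suc k)) i j \<le> V k - 1 + arrivals a (Suc k * b) (T (Suc k)) i j"
proof -
  let ?m = "k * b + b"
  have "(\<Sum>x<d - n. S (?m + x) i j) = (\<Sum>x<d - n. clearing n (d - n) (remaining n b d a k) x i j)"
  proof (intro sum.cong refl)
    fix x assume x: "x \<in> {..<d - n}"
    have "?m + x = T k + (b - d + x)" using n by simp
    then show "S (?m + x) i j = clearing n (d - n) (remaining n b d a k) x i j"
      using schedule_frame[of "b - d + x" k] x n by (simp only:) auto
  qed
  then have "remaining n b d a k i j \<le> (\<Sum>x<d - n. S (?m + x) i j)"
    using clearing_clears[of n "remaining n b d a k" "d - n" i j]
      remaining_row_sum remaining_col_sum assms by simp
  then have 1: "Q (?m + (d - n)) i j \<le> V k + arrivals a ?m (?m + (d - n)) i j"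
    using queue_clearing_phase[OF assms, of "d - n"] by simp
  \<comment> \<open>The last \<open>n\<close> steps of the frame form a full round-robin cycle,
    hence offer every queue exactly one service.\<close>
  have "(\<Sum>v<n. S (?m + (d - n) + v) i j) = (\<Sum>v<n. round_robin n (b - n + v) i j)"
  proof (intro sum.cong refl)
    fix v assume v: "v \<in> {..<n}"
    have "?m + (d - n) + v = T k + (b - n + v)" using n by simp
    then show "S (?m + (d - n) + v) i j = round_robin n (b - n + v) i j"
      using schedule_frame[of "b - n + v" k] v n by (simp only:) auto
  qed
  also have "\<dots> = (\<Sum>v=b - n..<b - n + n. round_robin n v i j)"
    by (rule sum.reindex_bij_witness[of _ "\<lambda>v. v - (b - n)" "\<lambda>v. b - n + v"]) auto
  also have "\<dots> = 1" by (rule round_robin_cycle) (use assms in auto)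
  finally have 2: "(\<Sum>v<n. S (?m + (d - n) + v) i j) = 1" .
  have T: "?m + (d - n) + n = ?m + d" "Suc k * b = ?m" using n by simp_all
  have 3: "arrivals a ?m (?m + (d - n) + n) i j
      = arrivals a ?m (?m + (d - n)) i j + arrivals a (?m + (d - n)) (?m + (d - n) + n) i j"
    by (rule arrivals_append) auto
  have 4: "Q (?m + (d - n) + n) i j
      \<le> (Q (?m + (d - n)) i j - 1) + arrivals a (?m + (d - n)) (?m + (d - n) + n) i j"
    using queues_lindley[of S a "?m + (d - n)" n i j] unfolding 2 .
  \<comment> \<open>That one service reduces the backlog bound; if \<open>V k = 0\<close>,
    truncation makes the claim weaker and it holds anyway.\<close>
  have "Q (?m + (d - n) + n) i j \<le> V k - 1 + arrivals a ?m (?m + (d - n) + n) i j"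
    unfolding 3 using 1 4 by arith
  then show ?thesis unfolding T .
qed

text \<open>Invariant over frames. A good batch is cleared completely and one unit of backlog with
  it; after a bad one, its arrivals, at most \<open>b\<close> per queue, are added to the
  backlog.\<close>

lemma queue_frame_start:
  assumes "i \<in> {1..n}" "j \<in> {1..n}"
  shows "Q (T k) i j \<le> V k + arrivals a (k * b) (T k) i j"
proof (induction k)
  case 0
  then show ?case using queues_lindley[of S a 0 d i j] by simp
next
  case (Suc k)
  show ?case
  proof (cases "good k")
    case True
    then show ?thesis using queue_frame_end[OF Suc True assms] by simp
  next
    case False
    have "T k + b = T (Suc k)" by simp
    then have "Q (T (Suc k)) i j \<le> V k + arrivals a (k * b) (T (Suc k)) i j"
      using queue_frame_crude[OF Suc, of b] by metis
    also have "arrivals a (k * b) (T (Suc k)) i j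
        = arrivals a (k * b) (Suc k * b) i j + arrivals a (Suc k * b) (T (Suc k)) i j"
      by (rule arrivals_append) auto
    also have "arrivals a (k * b) (Suc k * b) i j \<le> b"
      using arrivals_le[of "k * b" "Suc k * b" i j] by simp
    finally show ?thesis using False by simp
  qed
qed

lemma total_queue_crude:
  "(\<Sum>i=1..n. \<Sum>j=1..n. Q (T k + u) i j)
    \<le> n\<^sup>2 * V k + (\<Sum>i=1..n. \<Sum>j=1..n. arrivals a (k * b) (T k + u) i j)"
proof -
  have "(\<Sum>i=1..n. \<Sum>j=1..n. Q (T k + u) i j)
      \<le> (\<Sum>i=1..n. \<Sum>j=1..n. V k + arrivals a (k * b) (T k + u) i j)"
    by (intro sum_mono queue_frame_crude queue_frame_start) auto
  then show ?thesis by (simp add: sum.distrib power2_eq_square algebra_simps)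
qed

lemma total_queue_bad:
  assumes "u < b"
  shows "(\<Sum>i=1..n. \<Sum>j=1..n. Q (T k + u) i j) \<le> n\<^sup>2 * V k + n\<^sup>2 * (2 * b)"
proof -
  have "(\<Sum>i=1..n. \<Sum>j=1..n. Q (T k + u) i j) \<le> (\<Sum>i=1..n. \<Sum>j=1..n. V k + 2 * b)"
  proof (intro sum_mono)
    fix i j assume "i \<in> {1..n}" "j \<in> {1..n}"
    then show "Q (T k + u) i j \<le> V k + 2 * b"
      using queue_frame_crude[OF queue_frame_start, of i j k u]
        arrivals_le[of "k * b" "T k + u" i j] assms n by simp
  qed
  then show ?thesis by (simp add: power2_eq_square algebra_simps)
qed

lemma total_queue_good_early:
  assumes "good k" "u \<le> b - d"
  shows "(\<Sum>i=1..n. \<Sum>j=1..n. Q (T k + u) i j) + n * u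
    \<le> n\<^sup>2 * V k + (\<Sum>i=1..n. \<Sum>j=1..n. arrivals a (k * b) (T k + u) i j)"
proof -
  have "(\<Sum>i=1..n. \<Sum>j=1..n. Q (T k + u) i j) + n * u
      = (\<Sum>i=1..n. \<Sum>j=1..n. Q (T k + u) i j + (\<Sum>v<u. round_robin n v i j))"
    by (simp add: sum.distrib sum_round_robin del: One_nat_def)
  also have "\<dots> \<le> (\<Sum>i=1..n. \<Sum>j=1..n. V k + arrivals a (k * b) (T k + u) i j)"
    using assms by (intro sum_mono queue_round_robin_phase queue_frame_start) auto
  finally show ?thesis by (simp add: sum.distrib power2_eq_square algebra_simps)
qed

lemma total_queue_good_late:
  assumes "good k" "b - d \<le> u"
  shows "(\<Sum>i=1..n. \<Sum>j=1..n. Q (T k + u) i j)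
    \<le> n\<^sup>2 * V k + n * d + (\<Sum>i=1..n. \<Sum>j=1..n. arrivals a (k * b + b) (T k + u) i j)"
proof -
  define v where "v = u - (b - d)"
  have v: "k * b + b + v = T k + u" using assms n by (simp add: v_def)
  have "(\<Sum>i=1..n. \<Sum>j=1..n. Q (T k + u) i j)
      \<le> (\<Sum>i=1..n. \<Sum>j=1..n. V k + remaining n b d a k i j + arrivals a (k * b + b) (T k + u) i j)"
  proof (intro sum_mono)
    fix i j assume ij: "i \<in> {1..n}" "j \<in> {1..n}"
    show "Q (T k + u) i j \<le> V k + remaining n b d a k i j + arrivals a (k * b + b) (T k + u) i j"
      using queue_clearing_phase[OF queue_frame_start[OF ij] assms(1) ij, of v] by (simp add: v)
  qed
  also have "\<dots> = n\<^sup>2 * V k + (\<Sum>i=1..n. \<Sum>j=1..n. remaining n b d a k i j)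
      + (\<Sum>i=1..n. \<Sum>j=1..n. arrivals a (k * b + b) (T k + u) i j)"
    by (simp add: sum.distrib power2_eq_square algebra_simps)
  also have "(\<Sum>i=1..n. \<Sum>j=1..n. remaining n b d a k i j) \<le> (\<Sum>i=1..n. d)"
    using remaining_row_sum[OF assms(1)] by (intro sum_mono) (meson diff_le_self order_trans)
  finally show ?thesis by simp
qed

text \<open>The good-case bound is stated for all batches, with an error term for bad ones. The mean
  of \<open>C\<close> can then be taken without conditioning on \<open>good k\<close>.\<close>

lemma total_queue_le:
  fixes k u :: nat
  assumes "u < b"
  defines "C \<equiv> \<lambda>s. \<Sum>i=1..n. \<Sum>j=1..n. real (arrivals a s (T k + u) i j)"
  shows "(\<Sum>i=1..n. \<Sum>j=1..n. real (Q (T k + u) i j))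
    \<le> real n ^ 2 * real (V k) + (if u \<le> b - d then C (k * b) - real (n * u) else real (n * d) + C (k * b + b))
      + 2 * real n ^ 2 * real b * of_bool (\<not> good k)"
proof -
  let ?q = "\<Sum>i=1..n. \<Sum>j=1..n. Q (T k + u) i j"
  let ?c = "\<lambda>s. \<Sum>i=1..n. \<Sum>j=1..n. arrivals a s (T k + u) i j"
  have q: "(\<Sum>i=1..n. \<Sum>j=1..n. real (Q (T k + u) i j)) = real ?q" by simp
  have C: "C s = real (?c s)" for s by (simp add: C_def)
  show ?thesis
  proof (cases "good k")
    case True
    show ?thesis
    proof (cases "u \<le> b - d")
      case early: True
      have "real (?q + n * u) \<le> real (n\<^sup>2 * V k + ?c (k * b))"
        using total_queue_good_early[OF True early] by (simp only: of_nat_le_iff)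
      with True early show ?thesis unfolding q C by simp
    next
      case False
      have "real ?q \<le> real (n\<^sup>2 * V k + n * d + ?c (k * b + b))"
        using total_queue_good_late[OF True, of u] False by (simp only: of_nat_le_iff)
      with True False show ?thesis unfolding q C by simp
    qed
  next
    case False
    have "real ?q \<le> real (n\<^sup>2 * V k + n\<^sup>2 * (2 * b))"
      using total_queue_bad[OF assms(1), of k] by (simp only: of_nat_le_iff)
    then have 1: "real ?q \<le> real n ^ 2 * real (V k) + 2 * real n ^ 2 * real b" by simp
    show ?thesis
    proof (cases "u \<le> b - d")
      case early: True
      \<comment> \<open>On a bad batch the negative term \<open>- n * u\<close> is not justified by
        service; it is paid for by part of the error term, since \<open>u < b\<close>.\<close>
      have "?q + n * u \<le> n\<^sup>2 * V k + ?c (k * b) + n\<^sup>2 * b"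
      proof -
        have "n * u \<le> n * n * b" using assms(1) n by (intro mult_le_mono) auto
        then show ?thesis using total_queue_crude[of k u] unfolding power2_eq_square by linarith
      qed
      then have "real (?q + n * u) \<le> real (n\<^sup>2 * V k + ?c (k * b) + n\<^sup>2 * b)"
        by (simp only: of_nat_le_iff)
      then have "real ?q + real (n * u) \<le> real n ^ 2 * real (V k) + real (?c (k * b)) + real n ^ 2 * real b"
        by simp
      moreover have "0 \<le> real n ^ 2 * real b" by simp
      ultimately have "real ?q \<le> real n ^ 2 * real (V k) + (real (?c (k * b)) - real (n * u))
          + 2 * real n ^ 2 * real b"
        by linarith
      with False early show ?thesis unfolding q C by simp
    next
      case False
      have "0 \<le> real (n * d) + real (?c (k * b + b))"
        unfolding of_nat_add[symmetric] by (rule of_nat_0_le_iff)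
      with 1 have "real ?q \<le> real n ^ 2 * real (V k) + (real (n * d) + real (?c (k * b + b)))
          + 2 * real n ^ 2 * real b"
        by linarith
      with False \<open>\<not> good k\<close> show ?thesis unfolding q C by simp
    qed
  qed
qed

end

subsection \<open>Independent Bernoulli variables\<close>

lemma finite_set_Pi_pmf:
  assumes "finite I" "\<And>i. i \<in> I \<Longrightarrow> finite (set_pmf (p i))"
  shows "finite (set_pmf (Pi_pmf I dflt p))"
  using assms by (simp add: set_Pi_pmf finite_PiE_dflt)

text \<open>\<open>F\<close> and \<open>G\<close> factor through the restrictions to the disjoint
  sets \<open>A\<close> and \<open>B\<close>, which are independent under the product law.\<close>

lemma expectation_mult_Pi_pmf:
  fixes p :: "'a \<Rightarrow> 'b::countable pmf" and dflt :: 'b and F G :: "('a \<Rightarrow> 'b) \<Rightarrow> real"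
  assumes I: "finite I" "\<And>i. i \<in> I \<Longrightarrow> finite (set_pmf (p i))"
    and AB: "A \<subseteq> I" "B \<subseteq> I" "A \<inter> B = {}"
    and F: "\<And>x y. (\<And>i. i \<in> A \<Longrightarrow> x i = y i) \<Longrightarrow> F x = F y"
    and G: "\<And>x y. (\<And>i. i \<in> B \<Longrightarrow> x i = y i) \<Longrightarrow> G x = G y"
  defines "P \<equiv> Pi_pmf I dflt p"
  shows "measure_pmf.expectation P (\<lambda>x. F x * G x) = measure_pmf.expectation P F * measure_pmf.expectation P G"
proof -
  have ps: "prob_space (measure_pmf P)" by (rule prob_space_measure_pmf)
  have "prob_space.indep_vars (measure_pmf P) (\<lambda>_. count_space UNIV) (\<lambda>x f. f x) I"
    unfolding P_def by (rule indep_vars_Pi_pmf[OF I(1)])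
  from prob_space.indep_var_restrict[OF ps this AB(3,1,2)]
  have "prob_space.indep_var (measure_pmf P) (PiM A (\<lambda>_. count_space UNIV)) (\<lambda>x. restrict x A)
      (PiM B (\<lambda>_. count_space UNIV)) (\<lambda>x. restrict x B)" .
  moreover have "PiM K (\<lambda>_. count_space (UNIV :: 'b set)) = count_space (PiE K (\<lambda>_. UNIV))" if "K \<subseteq> I" for K
    using that I(1) finite_subset by (intro count_space_PiM_finite) auto
  ultimately have "prob_space.indep_var (measure_pmf P) borel (F \<circ> (\<lambda>x. restrict x A)) borel (G \<circ> (\<lambda>x. restrict x B))"
    using AB by (intro prob_space.indep_var_compose[OF ps]) auto
  moreover have "F \<circ> (\<lambda>x. restrict x A) = F" "G \<circ> (\<lambda>x. restrict x B) = G"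
    unfolding o_def by (intro ext, rule F, simp, intro ext, rule G, simp)
  ultimately have ind: "prob_space.indep_var (measure_pmf P) borel F borel G" by simp
  have "finite (set_pmf P)" unfolding P_def by (rule finite_set_Pi_pmf[OF I])
  then show ?thesis
    by (intro prob_space.indep_var_lebesgue_integral[OF ps] ind integrable_measure_pmf_finite)
qed

locale bernoulli_field =
  fixes I :: "'i set" and q :: real
  assumes fin: "finite I" and q: "0 \<le> q" "q \<le> 1"
begin

definition P :: "('i \<Rightarrow> nat) pmf" where
  "P = Pi_pmf I 0 (\<lambda>_. map_pmf of_bool (bernoulli_pmf q))"

lemma finite_set_P: "finite (set_pmf P)"
  unfolding P_def using fin by (intro finite_set_Pi_pmf) auto

lemma integrable_P [simp]: "integrable (measure_pmf P) f" for f :: "_ \<Rightarrow> real"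
  by (rule integrable_measure_pmf_finite[OF finite_set_P])

lemma expectation_mono:
  fixes f g :: "_ \<Rightarrow> real"
  assumes "\<And>x. x \<in> set_pmf P \<Longrightarrow> f x \<le> g x"
  shows "measure_pmf.expectation P f \<le> measure_pmf.expectation P g"
  by (rule integral_mono_AE) (use assms in \<open>auto simp: AE_measure_pmf_iff\<close>)

lemma set_P_le_1: "x \<in> set_pmf P \<Longrightarrow> x i \<le> 1"
proof -
  assume "x \<in> set_pmf P"
  then have "x i \<in> of_bool ` set_pmf (bernoulli_pmf q) \<or> x i = 0"
    using fin by (cases "i \<in> I") (auto simp: P_def set_Pi_pmf PiE_dflt_def)
  then show "x i \<le> 1" by auto
qed

lemma set_P_outside: "x \<in> set_pmf P \<Longrightarrow> i \<notin> I \<Longrightarrow> x i = 0"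
  using fin by (auto simp: P_def set_Pi_pmf PiE_dflt_def)

lemma expectation_coordinate:
  assumes "i \<in> I"
  shows "measure_pmf.expectation P (\<lambda>x. real (x i)) = q"
proof -
  have "measure_pmf.expectation P (\<lambda>x. real (x i))
      = measure_pmf.expectation (map_pmf (\<lambda>x. x i) P) real" by simp
  also have "map_pmf (\<lambda>x. x i) P = map_pmf of_bool (bernoulli_pmf q)"
    using assms by (simp add: P_def Pi_pmf_component[OF fin])
  also have "measure_pmf.expectation \<dots> real = q" using q by simp
  finally show ?thesis .
qed

lemma expectation_sum:
  assumes "J \<subseteq> I"
  shows "measure_pmf.expectation P (\<lambda>x. \<Sum>i\<in>J. real (x i)) = real (card J) * q"
  using assms by (subst Bochner_Integration.integral_sum) (auto simp: expectation_coordinate subset_iff)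

text \<open>The moment generating function factors over the coordinates, and each factor is bounded
  by \<open>1 + x \<le> exp x\<close>.\<close>

lemma expectation_exp_sum:
  assumes J: "J \<subseteq> I"
  shows "measure_pmf.expectation P (\<lambda>x. exp (\<theta> * (\<Sum>i\<in>J. real (x i)))) \<le> exp (card J * q * (exp \<theta> - 1))"
proof -
  let ?h = "\<lambda>i v. if i \<in> J then exp (\<theta> * real v) else 1"
  have finJ: "finite J" using J fin finite_subset by blast
  have "(\<lambda>x. exp (\<theta> * (\<Sum>i\<in>J. real (x i)))) = (\<lambda>x. \<Prod>i\<in>I. ?h i (x i))"
    using J fin by (simp add: sum_distrib_left exp_sum finJ prod.If_cases Int_absorb1)
  then have "measure_pmf.expectation P (\<lambda>x. exp (\<theta> * (\<Sum>i\<in>J. real (x i))))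
      = measure_pmf.expectation P (\<lambda>x. \<Prod>i\<in>I. ?h i (x i))" by simp
  also have "\<dots> = (\<Prod>i\<in>I. measure_pmf.expectation (map_pmf of_bool (bernoulli_pmf q)) (?h i))"
    unfolding P_def using fin by (intro expectation_prod_Pi_pmf integrable_measure_pmf_finite) auto
  also have "\<dots> = (\<Prod>i\<in>I. if i \<in> J then 1 + q * (exp \<theta> - 1) else 1)"
    using q by (intro prod.cong refl) (auto simp: algebra_simps)
  also have "\<dots> = (1 + q * (exp \<theta> - 1)) ^ card J"
    using J fin by (simp add: prod.If_cases Int_absorb1)
  also have "\<dots> \<le> exp (q * (exp \<theta> - 1)) ^ card J"
  \<comment> \<open>The base must be nonnegative for negative \<open>\<theta>\<close> too, which
    serves the lower tail.\<close>
  proof (rule power_mono[OF exp_ge_add_one_self])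
    have "q * (1 - exp \<theta>) \<le> 1"
      using q mult_mono[of q 1 "1 - exp \<theta>" 1] by (cases "exp \<theta> \<le> 1") (auto simp: mult_le_0_iff intro: order_trans[of _ 0])
    then show "0 \<le> 1 + q * (exp \<theta> - 1)" by (simp add: algebra_simps)
  qed
  also have "\<dots> = exp (card J * q * (exp \<theta> - 1))"
    by (simp add: exp_of_nat_mult[symmetric] mult.assoc)
  finally show ?thesis .
qed

text \<open>Markov's inequality for the exponential. The threshold \<open>c\<close> is for
  \<open>\<theta>\<close> times the sum, so one statement covers both tails, according to the sign
  of \<open>\<theta>\<close>.\<close>

lemma chernoff:
  assumes J: "J \<subseteq> I"
  shows "measure_pmf.prob P {x. c \<le> \<theta> * (\<Sum>i\<in>J. real (x i))} \<le> exp (card J * q * (exp \<theta> - 1) - c)"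
proof -
  let ?S = "\<lambda>x. \<theta> * (\<Sum>i\<in>J. real (x i))"
  have "measure_pmf.prob P {x. c \<le> ?S x} = measure_pmf.expectation P (indicator {x. c \<le> ?S x})"
    by simp
  also have "\<dots> \<le> measure_pmf.expectation P (\<lambda>x. exp (- c) * exp (?S x))"
    by (rule expectation_mono) (auto simp: indicator_def mult_exp_exp)
  also have "\<dots> = exp (- c) * measure_pmf.expectation P (\<lambda>x. exp (?S x))" by simp
  also have "\<dots> \<le> exp (- c) * exp (card J * q * (exp \<theta> - 1))"
    by (intro mult_left_mono expectation_exp_sum J) auto
  finally show ?thesis by (simp add: mult_exp_exp)
qed

end

subsection \<open>The joint law of the arrivals\<close>

definition slot_increments :: "nat \<Rightarrow> nat \<Rightarrow> (nat \<Rightarrow> nat \<Rightarrow> nat \<Rightarrow> 'a \<Rightarrow> nat) \<Rightarrow> 'a \<Rightarrow> nat \<times> nat \<times> nat \<Rightarrow> nat" where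
  "slot_increments n H A \<omega> = (\<lambda>(i, j, t).
     if i \<in> {1..n} \<and> j \<in> {1..n} \<and> t < H then A i j (Suc t) \<omega> - A i j t \<omega> else 0)"

abbreviation ports_slots :: "nat \<Rightarrow> nat \<Rightarrow> (nat \<times> nat \<times> nat) set" where
  "ports_slots n H \<equiv> {1..n} \<times> {1..n} \<times> {..<H}"

text \<open>Independence of the whole processes splits the event into cylinder events
  \<open>?E\<close> of the single queues; independence of the increments then splits each of these
  by slots.\<close>

lemma prob_slot_increments:
  assumes A: "bernoulli_arrivals n \<rho> M A" and n: "n \<ge> 1" and H: "H > 0"
  shows "measure M {\<omega> \<in> space M. \<forall>x\<in>ports_slots n H. slot_increments n H A \<omega> x = y x}
    = (\<Prod>x\<in>ports_slots n H. pmf (map_pmf of_bool (bernoulli_pmf (\<rho> / real n))) (y x))"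
proof -
  interpret prob_space M using A by (simp add: bernoulli_arrivals_def)
  let ?B = "map_pmf of_bool (bernoulli_pmf (\<rho> / real n)) :: nat pmf"
  let ?S = "\<Pi>\<^sub>M \<tau>\<in>UNIV. count_space (UNIV :: nat set)"
  let ?E = "\<lambda>(i, j). {g :: nat \<Rightarrow> nat. \<forall>t<H. g (Suc t) - g t = y (i, j, t)}"
  let ?X = "\<lambda>(i, j) \<omega>. \<lambda>\<tau>. A i j \<tau> \<omega>"
  have ind: "indep_vars (\<lambda>_. ?S) ?X ({1..n} \<times> {1..n})"
    using A by (simp add: bernoulli_arrivals_def)
  have E: "?E ij \<in> sets ?S" for ij
  proof -
    obtain i j where ij: "ij = (i, j)" by (cases ij)
    have "{g \<in> space ?S. \<forall>t<H. g (Suc t) - g t = y (i, j, t)} \<in> sets ?S"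
      by measurable
    then show ?thesis by (simp add: ij space_PiM)
  qed
  have inner: "prob (?X ij -` ?E ij \<inter> space M) = (\<Prod>t<H. pmf ?B (y (fst ij, snd ij, t)))"
    if ij_in: "ij \<in> {1..n} \<times> {1..n}" for ij
  proof -
    obtain i j where ij: "ij = (i, j)" "i \<in> {1..n}" "j \<in> {1..n}" using ij_in by auto
    let ?D = "\<lambda>\<tau> \<omega>. A i j \<tau> \<omega> - A i j (\<tau> - 1) \<omega>"
    have indD: "indep_vars (\<lambda>_. count_space UNIV) ?D {1..}"
      and D: "\<And>\<tau>. \<tau> \<ge> 1 \<Longrightarrow> distr M (count_space UNIV) (?D \<tau>) = measure_pmf ?B"
      using A ij by (auto simp: bernoulli_arrivals_def)
    have meas: "?D \<tau> \<in> measurable M (count_space UNIV)" if "\<tau> \<ge> 1" for \<tau>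
      using indD that by (auto simp: indep_vars_def)
    have eq: "?X ij -` ?E ij \<inter> space M = (\<Inter>\<tau>\<in>{1..H}. ?D \<tau> -` {y (i, j, \<tau> - 1)} \<inter> space M)"
    proof -
      have "(\<Inter>\<tau>\<in>{1..H}. ?D \<tau> -` {y (i, j, \<tau> - 1)} \<inter> space M)
          = (\<Inter>t<H. ?D (Suc t) -` {y (i, j, t)} \<inter> space M)"
        unfolding image_Suc_lessThan[symmetric] by simp
      also have "\<dots> = ?X ij -` ?E ij \<inter> space M" using H by (auto simp: ij(1))
      finally show ?thesis by (rule sym)
    qed
    have "prob (?X ij -` ?E ij \<inter> space M) = (\<Prod>\<tau>\<in>{1..H}. prob (?D \<tau> -` {y (i, j, \<tau> - 1)} \<inter> space M))"
      unfolding eq using H by (intro indep_varsD[OF indD]) auto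
    also have "\<dots> = (\<Prod>\<tau>\<in>{1..H}. pmf ?B (y (i, j, \<tau> - 1)))"
    proof (rule prod.cong[OF refl])
      fix \<tau> assume "\<tau> \<in> {1..H}"
      then have \<tau>: "\<tau> \<ge> 1" by simp
      have "prob (?D \<tau> -` {y (i, j, \<tau> - 1)} \<inter> space M)
          = measure (distr M (count_space UNIV) (?D \<tau>)) {y (i, j, \<tau> - 1)}"
        by (rule measure_distr[OF meas[OF \<tau>], symmetric]) simp
      then show "prob (?D \<tau> -` {y (i, j, \<tau> - 1)} \<inter> space M) = pmf ?B (y (i, j, \<tau> - 1))"
        unfolding D[OF \<tau>] measure_pmf_single .
    qed
    also have "\<dots> = (\<Prod>t<H. pmf ?B (y (i, j, t)))"
      by (rule prod.reindex_bij_witness[of _ Suc "\<lambda>\<tau>. \<tau> - 1"]) auto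
    finally show ?thesis by (simp only: ij fst_conv snd_conv)
  qed
  have eq: "{\<omega> \<in> space M. \<forall>x\<in>ports_slots n H. slot_increments n H A \<omega> x = y x}
      = (\<Inter>ij\<in>{1..n} \<times> {1..n}. ?X ij -` ?E ij \<inter> space M)"
    using n by (auto simp: slot_increments_def)
  have "prob {\<omega> \<in> space M. \<forall>x\<in>ports_slots n H. slot_increments n H A \<omega> x = y x}
      = (\<Prod>ij\<in>{1..n} \<times> {1..n}. prob (?X ij -` ?E ij \<inter> space M))"
    unfolding eq using n by (intro indep_varsD_finite[OF ind] E) auto
  also have "\<dots> = (\<Prod>ij\<in>{1..n} \<times> {1..n}. \<Prod>t<H. pmf ?B (y (fst ij, snd ij, t)))"
    by (rule prod.cong[OF refl inner])
  also have "\<dots> = (\<Prod>x\<in>ports_slots n H. pmf ?B (y x))"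
    by (simp add: prod.cartesian_product case_prod_unfold)
       (rule prod.reindex_bij_witness[of _ "\<lambda>(i, j, t). ((i, j), t)" "\<lambda>((i, j), t). (i, j, t)"]; auto)
  finally show ?thesis .
qed

text \<open>Both laws live on a countable space of restricted functions and agree on atoms, hence
  coincide. The product law has finite support, so every real function of the increments is
  integrable.\<close>

lemma expectation_slot_increments:
  fixes g :: "(nat \<times> nat \<times> nat \<Rightarrow> nat) \<Rightarrow> real"
  assumes A: "bernoulli_arrivals n \<rho> M A" and n: "n \<ge> 1" and H: "H > 0"
  defines "P \<equiv> Pi_pmf (ports_slots n H) 0 (\<lambda>_. map_pmf of_bool (bernoulli_pmf (\<rho> / real n)))"
  shows "integrable M (\<lambda>\<omega>. g (slot_increments n H A \<omega>))"
    and "(\<integral>\<omega>. g (slot_increments n H A \<omega>) \<partial>M) = measure_pmf.expectation P g"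
proof -
  interpret prob_space M using A by (simp add: bernoulli_arrivals_def)
  let ?B = "map_pmf of_bool (bernoulli_pmf (\<rho> / real n)) :: nat pmf"
  let ?I = "ports_slots n H"
  let ?N = "count_space (PiE ?I (\<lambda>_. UNIV :: nat set))"
  let ?R = "\<lambda>x :: nat \<times> nat \<times> nat \<Rightarrow> nat. restrict x ?I"
  let ?X = "slot_increments n H A"
  \<comment> \<open>Undoes \<open>restrict\<close>: the value outside the index set becomes
    \<open>0\<close> again, the default of \<open>Pi_pmf\<close>.\<close>
  define h where "h = (\<lambda>(x :: nat \<times> nat \<times> nat \<Rightarrow> nat) i. if i \<in> ?I then x i else 0)"
  have N: "PiM ?I (\<lambda>_. count_space UNIV) = ?N"
    by (intro count_space_PiM_finite) auto
  have "(\<lambda>\<omega>. ?X \<omega> x) \<in> measurable M (count_space UNIV)" if x: "x \<in> ?I" for x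
  proof -
    obtain i j t where ijt: "x = (i, j, t)" "i \<in> {1..n}" "j \<in> {1..n}" "t < H" using x by auto
    have "indep_vars (\<lambda>_. count_space UNIV) (\<lambda>\<tau> \<omega>. A i j \<tau> \<omega> - A i j (\<tau> - 1) \<omega>) {1..}"
      using A ijt by (auto simp: bernoulli_arrivals_def)
    then have "random_variable (count_space UNIV) (\<lambda>\<omega>. A i j (Suc t) \<omega> - A i j (Suc t - 1) \<omega>)"
      unfolding indep_vars_def by (metis atLeast_iff le_add1 plus_1_eq_Suc)
    then show ?thesis using ijt by (simp add: slot_increments_def)
  qed
  then have "(\<lambda>\<omega>. ?R (?X \<omega>)) \<in> measurable M (PiM ?I (\<lambda>_. count_space UNIV))"
    by (intro measurable_restrict) auto
  then have RX: "(\<lambda>\<omega>. ?R (?X \<omega>)) \<in> measurable M ?N" unfolding N .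
  have RP: "?R \<in> measurable (measure_pmf P) ?N" by auto
  have hX: "h (?R (?X \<omega>)) = ?X \<omega>" for \<omega>
    by (auto simp: h_def fun_eq_iff slot_increments_def)
  have hP: "h (?R x) = x" if "x \<in> set_pmf P" for x
    using that by (auto simp: P_def set_Pi_pmf PiE_dflt_def h_def fun_eq_iff)
  have "distr M ?N (\<lambda>\<omega>. ?R (?X \<omega>)) = distr (measure_pmf P) ?N ?R"
  proof (rule measure_eqI_countable[where A = "PiE ?I (\<lambda>_. UNIV)"])
    show "countable (PiE ?I (\<lambda>_. UNIV :: nat set))" by (intro countable_PiE) auto
    fix y assume y: "y \<in> PiE ?I (\<lambda>_. UNIV :: nat set)"
    interpret Q: prob_space "distr M ?N (\<lambda>\<omega>. ?R (?X \<omega>))" by (rule prob_space_distr[OF RX])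
    interpret Q': prob_space "distr (measure_pmf P) ?N ?R" by (rule measure_pmf.prob_space_distr[OF RP])
    have "measure (distr M ?N (\<lambda>\<omega>. ?R (?X \<omega>))) {y} = prob {\<omega> \<in> space M. \<forall>x\<in>?I. ?X \<omega> x = y x}"
      using RX y by (subst measure_distr) (auto intro!: arg_cong[where f = prob] simp: restrict_def PiE_def extensional_def fun_eq_iff)
    also have "\<dots> = (\<Prod>x\<in>?I. pmf ?B (y x))" by (rule prob_slot_increments[OF A n H])
    also have "\<dots> = (\<Prod>x\<in>?I. pmf ?B (h y x))" by (intro prod.cong refl) (simp add: h_def)
    also have "\<dots> = pmf P (h y)"
      unfolding P_def by (rule pmf_Pi'[symmetric]) (auto simp: h_def)
    also have "\<dots> = measure (measure_pmf P) {h y}" by (simp add: measure_pmf_single)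
    also have "\<dots> = measure (measure_pmf P) (?R -` {y} \<inter> space (measure_pmf P))"
    proof (rule measure_pmf.finite_measure_eq_AE)
      show "AE x in measure_pmf P. (x \<in> {h y}) = (x \<in> ?R -` {y} \<inter> space (measure_pmf P))"
      proof (rule AE_pmfI)
        fix x assume "x \<in> set_pmf P"
        from hP[OF this] have "h (?R x) = x" .
        moreover have "?R (h y) = y" using y by (auto simp: h_def fun_eq_iff PiE_def extensional_def)
        ultimately show "(x \<in> {h y}) = (x \<in> ?R -` {y} \<inter> space (measure_pmf P))" by auto
      qed
    qed auto
    also have "\<dots> = measure (distr (measure_pmf P) ?N ?R) {y}"
      using RP y by (subst measure_distr) auto
    finally show "emeasure (distr M ?N (\<lambda>\<omega>. ?R (?X \<omega>))) {y} = emeasure (distr (measure_pmf P) ?N ?R) {y}"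
      by (simp only: Q.emeasure_eq_measure Q'.emeasure_eq_measure)
  qed auto
  note D = this
  have fin: "finite (set_pmf P)" unfolding P_def by (intro finite_set_Pi_pmf) auto
  have gh: "(\<lambda>y. g (h y)) \<in> borel_measurable ?N" by simp
  have iP: "integrable (measure_pmf P) f" for f :: "_ \<Rightarrow> real" by (rule integrable_measure_pmf_finite[OF fin])
  have "integrable (distr (measure_pmf P) ?N ?R) (\<lambda>y. g (h y))"
    by (subst integrable_distr_eq[OF RP gh]) (rule iP)
  then have "integrable (distr M ?N (\<lambda>\<omega>. ?R (?X \<omega>))) (\<lambda>y. g (h y))" unfolding D .
  then show "integrable M (\<lambda>\<omega>. g (?X \<omega>))"
    by (subst (asm) integrable_distr_eq[OF RX gh]) (simp only: hX)
  have "(\<integral>\<omega>. g (?X \<omega>) \<partial>M) = (\<integral>y. g (h y) \<partial>distr M ?N (\<lambda>\<omega>. ?R (?X \<omega>)))"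
    by (subst integral_distr[OF RX gh]) (simp only: hX)
  also have "\<dots> = measure_pmf.expectation P (\<lambda>x. g (h (?R x)))"
    unfolding D by (rule integral_distr[OF RP gh])
  also have "\<dots> = measure_pmf.expectation P g"
  proof (rule integral_cong_AE)
    show "AE x in measure_pmf P. g (h (?R x)) = g x" by (rule AE_pmfI) (simp only: hP)
  qed auto
  finally show "(\<integral>\<omega>. g (?X \<omega>) \<partial>M) = measure_pmf.expectation P g" .
qed

subsection \<open>Mean queue sizes\<close>

declare One_nat_def [simp del]

definition causal :: "((nat \<Rightarrow> nmat) \<Rightarrow> nat \<Rightarrow> nmat) \<Rightarrow> bool" where
  "causal S \<longleftrightarrow> (\<forall>a a' t. (\<forall>x<t. a x = a' x) \<longrightarrow> S a t = S a' t)"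

text \<open>Past arrivals are recorded in the history, so a schedule that is causal in the arrivals
  is a policy. Entries of \<open>h ! u\<close> beyond the list are unspecified, and causality makes
  them irrelevant.\<close>

definition arrival_policy :: "((nat \<Rightarrow> nmat) \<Rightarrow> nat \<Rightarrow> nmat) \<Rightarrow> policy" where
  "arrival_policy S h q = S (\<lambda>u. snd (snd (h ! u))) (length h)"

definition arrival_path :: "(nat \<times> nat \<times> nat \<Rightarrow> nat) \<Rightarrow> nat \<Rightarrow> nmat" where
  "arrival_path x t i j = x (i, j, t)"

lemma causalD: "causal S \<Longrightarrow> (\<And>x. x < t \<Longrightarrow> a x = a' x) \<Longrightarrow> S a t = S a' t"
  unfolding causal_def by blast

lemma queues_cong:
  assumes "causal S" "\<And>x. x < t \<Longrightarrow> a x = a' x"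
  shows "queues (S a) a t = queues (S a') a' t"
  using assms(2)
proof (induction t)
  case (Suc t)
  have "S a t = S a' t" using Suc.prems by (intro causalD[OF assms(1)]) auto
  then show ?case using Suc by simp
qed simp

text \<open>Induction identifies the whole state, history included, because the history determines
  the next schedule.\<close>

lemma queue_arrival_policy:
  assumes S: "causal S"
  shows "queue n (arrival_policy S) A \<tau> =
    queues (S (\<lambda>t. slot_arrivals n A (Suc t))) (\<lambda>t. slot_arrivals n A (Suc t)) (\<tau> - 1)"
proof -
  define a where "a = (\<lambda>t. slot_arrivals n A (Suc t))"
  have "switch_state n (arrival_policy S) A t =
      (map (\<lambda>u. (queues (S a) a u, S a u, a u)) [0..<t], queues (S a) a t)" for t
  proof (induction t)
    case (Suc t)
    let ?h = "map (\<lambda>u. (queues (S a) a u, S a u, a u)) [0..<t]"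
    have \<sigma>: "arrival_policy S ?h q = S a t" for q
      unfolding arrival_policy_def by (simp, rule causalD[OF S]) simp
    have trunc: "x - s * of_bool (0 < x) = x - s" for x s :: nat by (cases x) auto
    have a: "slot_arrivals n A (Suc t) = a t" by (simp add: a_def)
    show ?case by (simp only: switch_state.simps Suc Let_def split \<sigma> trunc a) simp
  qed simp
  then show ?thesis by (simp add: queue_def a_def)
qed

text \<open>\<open>clearing\<close> needs all arrivals of batch \<open>k\<close>, but it is first
  used \<open>b - d\<close> steps into frame \<open>k\<close>, that is, from step
  \<open>k * b + b\<close> on.\<close>

lemma causal_batch_schedule:
  assumes b: "b > 0"
  shows "causal (batch_schedule n b d)"
  unfolding causal_def
proof (intro allI impI)
  fix a a' :: "nat \<Rightarrow> nmat" and t assume eq: "\<forall>x<t. a x = a' x"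
  define k u where "k = (t - d) div b" and "u = (t - d) mod b"
  have "clearing n (d - n) (remaining n b d a k) v = clearing n (d - n) (remaining n b d a' k) v"
    if "d \<le> t" "\<not> u < b - d" for v
  proof -
    have "t - d = k * b + u" by (simp add: k_def u_def)
    then have "k * b + b \<le> t" using that by linarith
    then have "remaining n b d a k = remaining n b d a' k"
      using eq by (auto simp: remaining_def arrivals_def fun_eq_iff intro!: arg_cong2[where f = minus] sum.cong)
    then show ?thesis by simp
  qed
  then show "batch_schedule n b d a t = batch_schedule n b d a' t"
    unfolding batch_schedule_def Let_def k_def[symmetric] u_def[symmetric] by auto
qed

text \<open>The windows of the queue condition end before step \<open>k * b + b\<close>, so goodness
  depends on the batch alone.\<close>

lemma good_batch_cong:
  assumes "d \<le> b" "\<And>x. x \<in> {k * b..<k * b + b} \<Longrightarrow> a x = a' x"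
  shows "good_batch n b d a k = good_batch n b d a' k"
proof -
  have "arrivals a (k * b) t = arrivals a' (k * b) t" if "t \<le> k * b + b" for t
    using assms(2) that by (auto simp: arrivals_def fun_eq_iff intro!: sum.cong)
  moreover have "k * b + d + u \<le> k * b + b" if "u < b - d" for u using that by simp
  ultimately show ?thesis unfolding good_batch_def by (auto simp: algebra_simps)
qed

lemma backlog_cong:
  assumes "d \<le> b" "\<And>x. x < k * b \<Longrightarrow> a x = a' x"
  shows "backlog n b d a k = backlog n b d a' k"
  using assms(2)
proof (induction k)
  case (Suc k)
  have "good_batch n b d a k = good_batch n b d a' k"
    using Suc.prems by (intro good_batch_cong assms(1)) auto
  then show ?case using Suc by simp
qed simp

text \<open>By causality the queue at slot \<open>\<tau>\<close> is a function of finitely many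
  increments, so its mean can be computed under the finite product law.\<close>

lemma arrival_policy_expectation:
  assumes A: "bernoulli_arrivals n \<rho> M A" and n: "n \<ge> 1" and S: "causal S" and H: "0 < H" "\<tau> \<le> H"
  defines "P \<equiv> Pi_pmf (ports_slots n H) 0 (\<lambda>_. map_pmf of_bool (bernoulli_pmf (\<rho> / real n)))"
  defines "q \<equiv> \<lambda>\<omega>. queue n (arrival_policy S) (\<lambda>i j \<tau>. A i j \<tau> \<omega>) \<tau>"
  shows "integrable M (\<lambda>\<omega>. real (q \<omega> i j))"
    and "(\<Sum>i=1..n. \<Sum>j=1..n. \<integral>\<omega>. real (q \<omega> i j) \<partial>M) =
      measure_pmf.expectation P (\<lambda>x. \<Sum>i=1..n. \<Sum>j=1..n. real (queues (S (arrival_path x)) (arrival_path x) (\<tau> - 1) i j))"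
proof -
  let ?g = "\<lambda>i j x. real (queues (S (arrival_path x)) (arrival_path x) (\<tau> - 1) i j)"
  have q: "real (q \<omega> i j) = ?g i j (slot_increments n H A \<omega>)" for \<omega> i j
  proof -
    let ?a = "\<lambda>t. slot_arrivals n (\<lambda>i j \<tau>. A i j \<tau> \<omega>) (Suc t)"
    have "?a t = arrival_path (slot_increments n H A \<omega>) t" if "t < \<tau> - 1" for t
      using that H by (auto simp: slot_arrivals_def arrival_path_def slot_increments_def fun_eq_iff)
    from queues_cong[OF S this] show ?thesis
      unfolding q_def queue_arrival_policy[OF S] by simp
  qed
  note * = expectation_slot_increments[OF A n H(1), folded P_def]
  show int: "integrable M (\<lambda>\<omega>. real (q \<omega> i j))" for i j unfolding q by (rule *)
  have "(\<Sum>i=1..n. \<Sum>j=1..n. \<integral>\<omega>. real (q \<omega> i j) \<partial>M) = (\<integral>\<omega>. (\<Sum>i=1..n. \<Sum>j=1..n. real (q \<omega> i j)) \<partial>M)"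
    by (simp add: int)
  also have "\<dots> = measure_pmf.expectation P (\<lambda>x. \<Sum>i=1..n. \<Sum>j=1..n. ?g i j x)"
    unfolding q by (rule *)
  finally show "(\<Sum>i=1..n. \<Sum>j=1..n. \<integral>\<omega>. real (q \<omega> i j) \<partial>M) =
      measure_pmf.expectation P (\<lambda>x. \<Sum>i=1..n. \<Sum>j=1..n. ?g i j x)" .
qed

section \<open>Exponential moments of the backlog and the mean total queue\<close>

locale switch_field = field: bernoulli_field "ports_slots n H" q for n H :: nat and q :: real +
  fixes b d :: nat and p :: real
  assumes n: "1 \<le> n" "n \<le> d" "d \<le> b"
    and q_le: "q \<le> 1 / real n"
    and p: "0 \<le> p" "12 * p * real b \<le> 1"
    and bad: "\<And>k. Suc k * b \<le> H \<Longrightarrow>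
      measure_pmf.prob field.P {x. \<not> good_batch n b d (arrival_path x) k} \<le> p"
begin

abbreviation "E \<equiv> measure_pmf.expectation field.P"
abbreviation "V k x \<equiv> backlog n b d (arrival_path x) k"
abbreviation "good k x \<equiv> good_batch n b d (arrival_path x) k"

text \<open>A good batch divides \<open>r ^ V\<close> by \<open>r\<close>, and
  \<open>1 - 1 / r\<close> corrects the case \<open>V = 0\<close>. A bad one multiplies it by
  \<open>r ^ b\<close>, which is at most \<open>exp 1\<close> and hence at most
  \<open>3\<close>.\<close>

lemma backlog_step:
  defines "r \<equiv> 1 + 1 / real b"
  shows "r ^ V (Suc k) x \<le> r ^ V k x / r + (1 - 1 / r) + 3 * (r ^ V k x * of_bool (\<not> good k x))"
proof -
  have b: "b > 0" using n by simp
  have r: "r > 1" using b by (simp add: r_def)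
  have pos: "0 \<le> r ^ V k x / r + (1 - 1 / r)" using r by simp
  show ?thesis
  proof (cases "good k x")
    case True
    have "r ^ (V k x - 1) \<le> r ^ V k x / r + (1 - 1 / r)"
      using r by (cases "V k x") auto
    then show ?thesis using True by simp
  next
    case False
    have "r ^ b \<le> exp (1 / real b) ^ b" unfolding r_def by (intro power_mono exp_ge_add_one_self) auto
    also have "\<dots> = exp 1" using b by (simp add: exp_of_nat_mult[symmetric])
    also have "\<dots> \<le> 3" by (rule exp_le)
    finally have "r ^ V k x * r ^ b \<le> r ^ V k x * 3" using r by (intro mult_left_mono) auto
    then show ?thesis using False pos by (simp add: power_add)
  qed
qed

text \<open>The backlog is determined by the steps before \<open>k * b\<close>, the goodness of
  batch \<open>k\<close> by its own steps.\<close>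

lemma expectation_backlog_bad:
  fixes r :: real
  assumes "Suc k * b \<le> H"
  shows "E (\<lambda>x. r ^ V k x * of_bool (\<not> good k x)) = E (\<lambda>x. r ^ V k x) * E (\<lambda>x. of_bool (\<not> good k x))"
proof -
  let ?A = "{1..n} \<times> {1..n} \<times> {..<k * b}" and ?B = "{1..n} \<times> {1..n} \<times> {k * b..<k * b + b}"
  \<comment> \<open>\<open>arrival_path\<close> also reads coordinates outside the index set.
    Setting them to \<open>0\<close> changes nothing almost surely and makes both factors depend
    only on \<open>?A\<close> and \<open>?B\<close>.\<close>
  define res where "res = (\<lambda>(x :: nat \<times> nat \<times> nat \<Rightarrow> nat) i. if i \<in> ports_slots n H then x i else 0)"
  have res: "res x = x" if "x \<in> set_pmf field.P" for x
    using field.set_P_outside[OF that] by (intro ext) (simp only: res_def if_split, simp)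
  have cong: "E f = E (\<lambda>x. f (res x))" for f :: "_ \<Rightarrow> real"
  proof (rule integral_cong_AE)
    show "AE x in measure_pmf field.P. f x = f (res x)" by (rule AE_pmfI) (simp only: res)
  qed auto
  have le: "k * b + b \<le> H" using assms by simp
  have path: "arrival_path (res x) t = arrival_path (res y) t"
    if "\<And>i. i \<in> {1..n} \<times> {1..n} \<times> {t} \<Longrightarrow> x i = y i" for x y t
    using that by (auto simp: arrival_path_def res_def fun_eq_iff)
  have "E (\<lambda>x. r ^ V k (res x) * of_bool (\<not> good k (res x)))
      = E (\<lambda>x. r ^ V k (res x)) * E (\<lambda>x. of_bool (\<not> good k (res x)))"
    unfolding field.P_def
  proof (rule expectation_mult_Pi_pmf[where A = ?A and B = ?B])
    show "?A \<subseteq> ports_slots n H" "?B \<subseteq> ports_slots n H" using le by auto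
    fix x y :: "nat \<times> nat \<times> nat \<Rightarrow> nat"
    show "r ^ V k (res x) = r ^ V k (res y)" if "\<And>i. i \<in> ?A \<Longrightarrow> x i = y i"
      using that by (intro arg_cong[where f = "\<lambda>m. r ^ m"] backlog_cong n path) auto
    show "of_bool (\<not> good k (res x)) = (of_bool (\<not> good k (res y)) :: real)" if "\<And>i. i \<in> ?B \<Longrightarrow> x i = y i"
      using that by (intro arg_cong[where f = "\<lambda>m. of_bool (\<not> m)"] good_batch_cong n path) auto
  qed auto
  then show ?thesis unfolding cong[of "\<lambda>x. r ^ V k x * of_bool (\<not> good k x)"] cong[of "\<lambda>x. r ^ V k x"]
      cong[of "\<lambda>x. of_bool (\<not> good k x)"] .
qed

lemma expectation_bad:
  assumes "Suc k * b \<le> H"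
  shows "E (\<lambda>x. of_bool (\<not> good k x)) \<le> p"
proof -
  have "E (\<lambda>x. of_bool (\<not> good k x)) = E (indicator {x. \<not> good k x})"
    by (intro Bochner_Integration.integral_cong) (auto simp: indicator_def)
  also have "\<dots> = measure_pmf.prob field.P {x. \<not> good k x}" by simp
  finally show ?thesis using bad[OF assms] by simp
qed

text \<open>With \<open>X\<close> the current moment, one batch contracts \<open>X - 1\<close> by
  the factor \<open>1 - 1 / (2 * b)\<close> and adds \<open>3 * p * X\<close>. Since
  \<open>3 * p \<le> 1 / (4 * b)\<close>, the net factor is at most \<open>1 - 1 / (4 * b)\<close>
  with input \<open>3 * p\<close>, whose fixed point is \<open>12 * p * b\<close>.\<close>

lemma expectation_backlog_exp:
  assumes "k * b \<le> H"
  shows "E (\<lambda>x. (1 + 1 / real b) ^ V k x) \<le> 1 + 12 * p * real b"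
  using assms
proof (induction k)
  case 0
  then show ?case using p by simp
next
  case (Suc k)
  define r where "r = 1 + 1 / real b"
  define X where "X = E (\<lambda>x. r ^ V k x)"
  have b: "real b \<ge> 1" using n by linarith
  have r: "r \<ge> 1" by (simp add: r_def)
  have X: "X \<le> 1 + 12 * p * real b" unfolding X_def r_def using Suc by simp
  have "E (\<lambda>x. 1) \<le> X" unfolding X_def using r by (intro field.expectation_mono) simp
  then have X1: "X \<ge> 1" by simp
  have "E (\<lambda>x. r ^ V (Suc k) x)
      \<le> E (\<lambda>x. r ^ V k x / r + (1 - 1 / r) + 3 * (r ^ V k x * of_bool (\<not> good k x)))"
    unfolding r_def by (intro field.expectation_mono backlog_step)
  also have "\<dots> = X / r + (1 - 1 / r) + 3 * E (\<lambda>x. r ^ V k x * of_bool (\<not> good k x))"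
    unfolding X_def by (subst Bochner_Integration.integral_add, simp, simp)+ simp
  also have "E (\<lambda>x. r ^ V k x * of_bool (\<not> good k x)) = X * E (\<lambda>x. of_bool (\<not> good k x))"
    unfolding X_def using Suc.prems by (intro expectation_backlog_bad) simp
  also have "\<dots> \<le> X * p"
    using Suc.prems X1 by (intro mult_left_mono expectation_bad) auto
  finally have 1: "E (\<lambda>x. r ^ V (Suc k) x) \<le> X / r + (1 - 1 / r) + 3 * (X * p)" by simp
  \<comment> \<open>In fact \<open>1 / r = 1 - 1 / (b + 1)\<close>, and
    \<open>b + 1 \<le> 2 * b\<close>.\<close>
  have "1 / r \<le> 1 - 1 / (2 * real b)" using b by (simp add: r_def field_simps)
  then have "(X - 1) * (1 / r) \<le> (X - 1) * (1 - 1 / (2 * real b))" using X1 by (intro mult_left_mono) auto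
  then have 2: "X / r + (1 - 1 / r) \<le> 1 + (X - 1) * (1 - 1 / (2 * real b))"
    by (simp add: diff_divide_distrib algebra_simps)
  have "3 * p \<le> 1 / (4 * real b)" using p b by (simp add: field_simps)
  then have "(X - 1) * (3 * p) \<le> (X - 1) * (1 / (4 * real b))" using X1 by (intro mult_left_mono) auto
  with 1 2 have "E (\<lambda>x. r ^ V (Suc k) x)
      \<le> 1 + (X - 1) * (1 - 1 / (2 * real b)) + (X - 1) * (1 / (4 * real b)) + 3 * p"
    by (simp add: algebra_simps)
  also have "\<dots> = 1 + (X - 1) * (1 - 1 / (4 * real b)) + 3 * p" using b by (simp add: field_simps)
  also have "\<dots> \<le> 1 + (12 * p * real b) * (1 - 1 / (4 * real b)) + 3 * p"
    using X b p by (intro add_mono mult_right_mono) (auto simp: field_simps)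
  also have "\<dots> = 1 + 12 * p * real b" using b by (simp add: field_simps)
  finally show ?case by (simp add: r_def)
qed

text \<open>Bernoulli's inequality turns the exponential moment into a mean: \<open>V\<close> is at
  most \<open>b\<close> times the excess of \<open>(1 + 1 / b) ^ V\<close> over
  \<open>1\<close>.\<close>

lemma expectation_backlog:
  assumes "k * b \<le> H"
  shows "E (\<lambda>x. real (V k x)) \<le> 12 * p * real b ^ 2"
proof -
  have b: "real b > 0" using n by simp
  have "E (\<lambda>x. real (V k x)) \<le> E (\<lambda>x. real b * (1 + 1 / real b) ^ V k x - real b)"
  proof (intro field.expectation_mono)
    fix x
    have "1 + real (V k x) * (1 / real b) \<le> (1 + 1 / real b) ^ V k x"
      by (intro Bernoulli_inequality) (simp add: order_trans[of _ 0])
    then have "real b * (1 + real (V k x) * (1 / real b)) \<le> real b * (1 + 1 / real b) ^ V k x"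
      using b by (intro mult_left_mono) auto
    then show "real (V k x) \<le> real b * (1 + 1 / real b) ^ V k x - real b"
      using b by (simp add: algebra_simps)
  qed
  also have "\<dots> = real b * E (\<lambda>x. (1 + 1 / real b) ^ V k x) - real b" by simp
  also have "\<dots> \<le> real b * (1 + 12 * p * real b) - real b"
    using expectation_backlog_exp[OF assms] by (intro diff_right_mono mult_left_mono) auto
  finally show ?thesis by (simp add: power2_eq_square algebra_simps)
qed

lemma expectation_arrivals:
  assumes "t \<le> H" "s \<le> t"
  shows "E (\<lambda>x. \<Sum>i=1..n. \<Sum>j=1..n. real (arrivals (arrival_path x) s t i j)) \<le> real n * (real t - real s)"
proof -
  let ?J = "{1..n} \<times> {1..n} \<times> {s..<t}"
  have "E (\<lambda>x. \<Sum>i=1..n. \<Sum>j=1..n. real (arrivals (arrival_path x) s t i j)) = E (\<lambda>x. \<Sum>i\<in>?J. real (x i))"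
    by (simp add: arrivals_def arrival_path_def sum.cartesian_product case_prod_unfold)
  also have "\<dots> = real (card ?J) * q" using assms by (intro field.expectation_sum) auto
  also have "\<dots> = real n * (real t - real s) * (real n * q)" using assms by (simp add: of_nat_diff)
  also have "\<dots> \<le> real n * (real t - real s) * 1"
  proof (rule mult_left_mono)
    show "real n * q \<le> 1" using q_le n by (simp add: field_simps)
  qed (use assms in simp)
  finally show ?thesis by simp
qed

text \<open>Before step \<open>d\<close>, fewer than \<open>d\<close> slots of arrivals have
  occurred. Early in a frame, \<open>d + u\<close> slots of arrivals minus \<open>n * u\<close>
  services leave a mean of at most \<open>n * d\<close>; late in it, at most \<open>n * d\<close>
  packets of the batch remain and fewer than \<open>d\<close> slots of newer arrivals are added. The
  other terms account for backlog and bad batches.\<close>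

lemma expectation_total_queue:
  assumes "t + 2 * b \<le> H"
  shows "E (\<lambda>x. \<Sum>i=1..n. \<Sum>j=1..n. real (queues (batch_schedule n b d (arrival_path x)) (arrival_path x) t i j))
    \<le> 12 * real n ^ 2 * p * real b ^ 2 + 2 * real n * real d + 2 * real n ^ 2 * real b * p"
proof (cases "t < d")
  case True
  have "E (\<lambda>x. \<Sum>i=1..n. \<Sum>j=1..n. real (queues (batch_schedule n b d (arrival_path x)) (arrival_path x) t i j))
      \<le> E (\<lambda>x. \<Sum>i=1..n. \<Sum>j=1..n. real (arrivals (arrival_path x) 0 t i j))"
  proof (intro field.expectation_mono sum_mono of_nat_mono)
    fix x i j
    show "queues (batch_schedule n b d (arrival_path x)) (arrival_path x) t i j \<le> arrivals (arrival_path x) 0 t i j"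
      using queues_lindley[of "batch_schedule n b d (arrival_path x)" "arrival_path x" 0 t i j] by simp
  qed
  also have "\<dots> \<le> real n * (real t - real 0)" using assms by (intro expectation_arrivals) auto
  also have "\<dots> \<le> 2 * real n * real d" using True by (simp add: mult_mono)
  finally show ?thesis using p by (simp add: add_increasing add_increasing2)
next
  case False
  define k u where "k = (t - d) div b" and "u = (t - d) mod b"
  have b: "b > 0" using n by simp
  have t: "t = k * b + d + u" using False by (simp add: k_def u_def)
  have u: "u < b" using b by (simp add: u_def)
  let ?C = "\<lambda>x s. \<Sum>i=1..n. \<Sum>j=1..n. real (arrivals (arrival_path x) s t i j)"
  let ?R = "\<lambda>x. if u \<le> b - d then ?C x (k * b) - real (n * u) else real (n * d) + ?C x (k * b + b)"
  have kb: "k * b \<le> H" "Suc k * b \<le> H" using assms t by auto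
  have R: "E ?R \<le> 2 * real n * real d"
  proof (cases "u \<le> b - d")
    case True
    have "E ?R = E (\<lambda>x. ?C x (k * b)) - real (n * u)" using True by simp
    also have "\<dots> \<le> real n * (real t - real (k * b)) - real (n * u)"
      using assms t by (intro diff_right_mono expectation_arrivals) auto
    also have "\<dots> = real n * real d" by (simp add: t algebra_simps)
    finally show ?thesis by (simp add: order_trans[of _ "real n * real d"])
  next
    case False
    have "E ?R = real (n * d) + E (\<lambda>x. ?C x (k * b + b))" using False by simp
    also have "\<dots> \<le> real (n * d) + real n * (real t - real (k * b + b))"
      using assms t False n by (intro add_left_mono expectation_arrivals) auto
    also have "\<dots> \<le> real (n * d) + real n * real d"
      using u by (intro add_left_mono mult_left_mono) (auto simp: t)
    also have "\<dots> = 2 * real n * real d" by simp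
    finally show ?thesis .
  qed
  have "E (\<lambda>x. \<Sum>i=1..n. \<Sum>j=1..n. real (queues (batch_schedule n b d (arrival_path x)) (arrival_path x) t i j))
      \<le> E (\<lambda>x. real n ^ 2 * real (V k x) + ?R x + 2 * real n ^ 2 * real b * of_bool (\<not> good k x))"
  proof (intro field.expectation_mono)
    fix x assume "x \<in> set_pmf field.P"
    then interpret B: batching n b d "arrival_path x"
      using n field.set_P_le_1 by unfold_locales (auto simp: arrival_path_def)
    show "(\<Sum>i=1..n. \<Sum>j=1..n. real (queues (batch_schedule n b d (arrival_path x)) (arrival_path x) t i j))
        \<le> real n ^ 2 * real (V k x) + ?R x + 2 * real n ^ 2 * real b * of_bool (\<not> good k x)"
      using B.total_queue_le[OF u, of k] unfolding t .
  qed
  also have "\<dots> = real n ^ 2 * E (\<lambda>x. real (V k x)) + E ?R + 2 * real n ^ 2 * real b * E (\<lambda>x. of_bool (\<not> good k x))"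
    by (subst Bochner_Integration.integral_add, simp, simp)+ simp
  also have "\<dots> \<le> real n ^ 2 * (12 * p * real b ^ 2) + 2 * real n * real d + 2 * real n ^ 2 * real b * p"
    using kb by (intro add_mono mult_left_mono R expectation_backlog expectation_bad) auto
  finally show ?thesis by (simp add: algebra_simps)
qed

end

subsection \<open>Concentration of the arrivals of a batch\<close>

text \<open>Second-order estimate for the lower tail, from \<open>1 + x \<le> exp x\<close> and
  \<open>(1 - x + x ^ 2) * (1 + x) = 1 + x ^ 3\<close>.\<close>

lemma exp_minus_le:
  assumes "0 \<le> (x::real)"
  shows "exp (- x) \<le> 1 - x + x\<^sup>2"
proof -
  have "exp (- x) \<le> 1 / (1 + x)"
    using exp_ge_add_one_self[of x] assms by (simp add: exp_minus field_simps)
  also have "\<dots> \<le> 1 - x + x\<^sup>2"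
  proof -
    have "(1 - x + x\<^sup>2) * (1 + x) = 1 + x ^ 3" by algebra
    also have "\<dots> \<ge> 1" using assms by simp
    finally show ?thesis using assms by (simp add: pos_divide_le_eq)
  qed
  finally show ?thesis .
qed

text \<open>\<open>row\<close> controls the load of a port, input and output alike, and
  \<open>col\<close> the supply of a single queue. The guards \<open>d < b\<close> reflect that a
  frame with \<open>d = b\<close> has no round-robin phase.\<close>

locale batch_concentration = field: bernoulli_field "ports_slots n H" "(1 - 1 / f) / real n"
  for n H :: nat and f :: real +
  fixes b d :: nat and \<epsilon> :: real
  assumes n: "1 \<le> n" and f: "1 \<le> f" and d: "d \<le> b"
    and b: "2 * real n * f \<le> real b" and row: "exp (- real b / (16 * f\<^sup>2)) \<le> \<epsilon>"
    and d_large: "d < b \<Longrightarrow> 4 * real b / f \<le> real d" "d < b \<Longrightarrow> 8 * real n \<le> real d"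
    and col: "d < b \<Longrightarrow> exp (- (real d)\<^sup>2 / (16 * real n * real b)) \<le> \<epsilon>"
begin

text \<open>The mean load \<open>b * (1 - 1 / f)\<close> lies \<open>b / f\<close> below
  \<open>b\<close>, and \<open>n\<close> uses at most half of that gap.\<close>

lemma prob_overload:
  assumes J: "J \<subseteq> ports_slots n H" and card: "card J = n * b"
  shows "measure_pmf.prob field.P {x. \<not> (\<Sum>i\<in>J. x i) \<le> b - n} \<le> \<epsilon>"
proof -
  \<comment> \<open>Minimizes the exponent \<open>b * \<theta> ^ 2 - \<theta> * b / (2 * f)\<close>
    obtained at the end.\<close>
  define \<theta> where "\<theta> = 1 / (4 * f)"
  have \<theta>: "0 \<le> \<theta>" "\<theta> \<le> 1" using f by (auto simp: \<theta>_def)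
  have "{x. \<not> (\<Sum>i\<in>J. x i) \<le> b - n} \<subseteq> {x. \<theta> * (real b - real n) \<le> \<theta> * (\<Sum>i\<in>J. real (x i))}"
  proof safe
    fix x :: "nat \<times> nat \<times> nat \<Rightarrow> nat" assume "\<not> (\<Sum>i\<in>J. x i) \<le> b - n"
    then have "real b - real n \<le> real (\<Sum>i\<in>J. x i)" by linarith
    then show "\<theta> * (real b - real n) \<le> \<theta> * (\<Sum>i\<in>J. real (x i))"
      using \<theta> by (intro mult_left_mono) auto
  qed
  then have "measure_pmf.prob field.P {x. \<not> (\<Sum>i\<in>J. x i) \<le> b - n}
      \<le> measure_pmf.prob field.P {x. \<theta> * (real b - real n) \<le> \<theta> * (\<Sum>i\<in>J. real (x i))}"
    by (intro measure_pmf.finite_measure_mono) auto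
  also have "\<dots> \<le> exp (real (card J) * ((1 - 1 / f) / real n) * (exp \<theta> - 1) - \<theta> * (real b - real n))"
    by (rule field.chernoff[OF J])
  also have "real (card J) * ((1 - 1 / f) / real n) = real b * (1 - 1 / f)"
    using n by (simp add: card)
  also have "exp (real b * (1 - 1 / f) * (exp \<theta> - 1) - \<theta> * (real b - real n)) \<le> exp (- real b / (16 * f\<^sup>2))"
  proof -
    have "real b * (1 - 1 / f) * (exp \<theta> - 1) \<le> real b * (1 - 1 / f) * (\<theta> + \<theta>\<^sup>2)"
      using exp_bound[OF \<theta>] f by (intro mult_left_mono) auto
    moreover have "real b * (1 - 1 / f) * (\<theta> + \<theta>\<^sup>2)
        = \<theta> * real b - \<theta> * (real b / f) + real b * (1 - 1 / f) * \<theta>\<^sup>2"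
      by (simp add: algebra_simps)
    moreover have "real b * (1 - 1 / f) * \<theta>\<^sup>2 \<le> real b * 1 * \<theta>\<^sup>2"
      using f by (intro mult_right_mono mult_left_mono) auto
    moreover have "real n \<le> real b / (2 * f)" using b f by (simp add: field_simps)
    then have "\<theta> * real n \<le> \<theta> * (real b / (2 * f))" using \<theta> by (intro mult_left_mono) auto
    moreover have "\<theta> * (real b / f) = 2 * (\<theta> * (real b / (2 * f)))" by simp
    moreover have "\<theta> * (real b - real n) = \<theta> * real b - \<theta> * real n" by (simp add: algebra_simps)
    ultimately have "real b * (1 - 1 / f) * (exp \<theta> - 1) - \<theta> * (real b - real n)
        \<le> real b * \<theta>\<^sup>2 - \<theta> * (real b / (2 * f))"
      by linarith
    also have "\<dots> = - real b / (16 * f\<^sup>2)"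
      using f by (simp add: \<theta>_def field_simps power2_eq_square)
    finally show ?thesis by simp
  qed
  finally show ?thesis using row by simp
qed

text \<open>The delay gives the queue a head start of mean about \<open>d / n\<close> over the
  service. After rounding and the load deficit, at least \<open>d / (2 * n)\<close> of it is left as
  a margin.\<close>

lemma prob_idle_service:
  assumes J: "J \<subseteq> ports_slots n H" and card: "card J = d + u" and u: "u < b - d"
  shows "measure_pmf.prob field.P {x. (\<Sum>i\<in>J. x i) < Suc u div n + 1} \<le> \<epsilon>"
proof -
  have db: "d < b" using u by simp
  \<comment> \<open>Minimizes \<open>(b / n) * \<theta> ^ 2 - \<theta> * d / (2 * n)\<close>, the
    final exponent.\<close>
  define \<theta> where "\<theta> = real d / (4 * real b)"
  define r where "r = real u / real n + 2"
  define N where "N = real d + real u"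
  have n0: "real n \<ge> 1" using n by simp
  have b0: "real b > 0" using db by simp
  have \<theta>: "0 \<le> \<theta>" by (simp add: \<theta>_def)
  have "{x. (\<Sum>i\<in>J. x i) < Suc u div n + 1} \<subseteq> {x. - \<theta> * r \<le> - \<theta> * (\<Sum>i\<in>J. real (x i))}"
  proof safe
    fix x :: "nat \<times> nat \<times> nat \<Rightarrow> nat" assume "(\<Sum>i\<in>J. x i) < Suc u div n + 1"
    then have "(\<Sum>i\<in>J. x i) \<le> Suc u div n" by simp
    then have "real (\<Sum>i\<in>J. x i) \<le> real (Suc u div n)" by (rule of_nat_mono)
    then have "(\<Sum>i\<in>J. real (x i)) \<le> real (Suc u div n)" by simp
    also have "\<dots> \<le> real (Suc u) / real n" by (rule of_nat_div_le_of_nat)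
    also have "\<dots> \<le> r" using n0 by (simp add: r_def field_simps)
    finally show "- \<theta> * r \<le> - \<theta> * (\<Sum>i\<in>J. real (x i))"
      using \<theta> by (simp add: mult_left_mono)
  qed
  then have "measure_pmf.prob field.P {x. (\<Sum>i\<in>J. x i) < Suc u div n + 1}
      \<le> measure_pmf.prob field.P {x. - \<theta> * r \<le> - \<theta> * (\<Sum>i\<in>J. real (x i))}"
    by (intro measure_pmf.finite_measure_mono) auto
  also have "\<dots> \<le> exp (real (card J) * ((1 - 1 / f) / real n) * (exp (- \<theta>) - 1) - (- \<theta> * r))"
    by (rule field.chernoff[OF J])
  also have "real (card J) = N" by (simp add: card N_def)
  also have "exp (N * ((1 - 1 / f) / real n) * (exp (- \<theta>) - 1) - (- \<theta> * r))
      \<le> exp (- (real d)\<^sup>2 / (16 * real n * real b))"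
  proof -
    have N: "0 \<le> N" "N \<le> real b" using u by (auto simp: N_def)
    let ?m = "N * ((1 - 1 / f) / real n)"
    have m: "0 \<le> ?m" using N f n0 by simp
    have "?m \<le> N / real n" using N f n0 by (simp add: field_simps)
    also have "\<dots> \<le> real b / real n" using N n0 by (simp add: divide_right_mono)
    finally have m2: "?m \<le> real b / real n" .
    have "?m * (exp (- \<theta>) - 1) \<le> ?m * (- \<theta> + \<theta>\<^sup>2)"
      using exp_minus_le[OF \<theta>] m by (intro mult_left_mono) auto
    also have "\<dots> = - \<theta> * ?m + ?m * \<theta>\<^sup>2" by (simp only: distrib_left mult.commute[of "- \<theta>"])
    also have "\<dots> \<le> - \<theta> * ?m + real b / real n * \<theta>\<^sup>2"
      using mult_right_mono[OF m2, of "\<theta>\<^sup>2"] by simp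
    finally have 1: "?m * (exp (- \<theta>) - 1) + \<theta> * r \<le> \<theta> * (r - ?m) + real b / real n * \<theta>\<^sup>2"
      unfolding right_diff_distrib[of \<theta>] by linarith
    \<comment> \<open>The two corrections \<open>2 * n\<close> and \<open>N / f \<le> b / f\<close>
      are each at most \<open>d / 4\<close> by \<open>d_large\<close>.\<close>
    have "r - ?m = (2 * real n - real d + N / f) / real n"
      using n0 f by (simp add: r_def N_def field_simps)
    also have "\<dots> \<le> (- real d / 2) / real n"
    proof (rule divide_right_mono)
      have "N / f \<le> real b / f" using N f by (intro divide_right_mono) auto
      then show "2 * real n - real d + N / f \<le> - real d / 2"
        using d_large[OF db] by simp
    qed simp
    finally have "\<theta> * (r - ?m) \<le> \<theta> * ((- real d / 2) / real n)" using \<theta> by (intro mult_left_mono)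
    with 1 have "?m * (exp (- \<theta>) - 1) + \<theta> * r \<le> \<theta> * ((- real d / 2) / real n) + real b / real n * \<theta>\<^sup>2"
      by linarith
    also have "\<dots> = - (real d)\<^sup>2 / (16 * real n * real b)"
      using n0 b0 by (simp add: \<theta>_def field_simps power2_eq_square)
    finally show ?thesis by simp
  qed
  finally show ?thesis using col[OF db] by simp
qed

text \<open>Union bound over at most \<open>n ^ 2 * b\<close> pairs of queue and step and over
  \<open>2 * n\<close> ports.\<close>

lemma prob_bad_batch:
  assumes k: "Suc k * b \<le> H"
  shows "measure_pmf.prob field.P {x. \<not> good_batch n b d (arrival_path x) k}
    \<le> ((real n)\<^sup>2 * real b + 2 * real n) * \<epsilon>"
proof -
  let ?pr = "measure_pmf.prob field.P"
  let ?I = "{k * b..<k * b + b}"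
  define Bq where "Bq = (\<lambda>(i, j, u). {x :: nat \<times> nat \<times> nat \<Rightarrow> nat. u < b - d \<and>
    (\<Sum>i\<in>{i} \<times> {j} \<times> {k * b..<k * b + d + u}. x i) < Suc u div n + 1})"
  define Br where "Br = (\<lambda>i. {x :: nat \<times> nat \<times> nat \<Rightarrow> nat. \<not> (\<Sum>i\<in>{i} \<times> {1..n} \<times> ?I. x i) \<le> b - n})"
  define Bc where "Bc = (\<lambda>j. {x :: nat \<times> nat \<times> nat \<Rightarrow> nat. \<not> (\<Sum>i\<in>{1..n} \<times> {j} \<times> ?I. x i) \<le> b - n})"
  have kb: "k * b + b \<le> H" using k by simp
  have \<epsilon>: "0 \<le> \<epsilon>" using row exp_ge_zero order_trans by blast
  have q: "?pr (Bq z) \<le> \<epsilon>" if z: "z \<in> {1..n} \<times> {1..n} \<times> {..<b}" for z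
  proof -
    obtain i j u where [simp]: "z = (i, j, u)" by (cases z)
    show ?thesis
    proof (cases "u < b - d")
      case True
      have "?pr {x. (\<Sum>i\<in>{i} \<times> {j} \<times> {k * b..<k * b + d + u}. x i) < Suc u div n + 1} \<le> \<epsilon>"
        using z kb True by (intro prob_idle_service) auto
      then show ?thesis using True by (simp add: Bq_def)
    qed (simp add: Bq_def \<epsilon>)
  qed
  have r: "?pr (Br i) \<le> \<epsilon>" if "i \<in> {1..n}" for i
    unfolding Br_def using that kb by (intro prob_overload) auto
  have c: "?pr (Bc j) \<le> \<epsilon>" if "j \<in> {1..n}" for j
    unfolding Bc_def using that kb by (intro prob_overload) auto
  let ?Z = "{1..n} \<times> {1..n} \<times> {..<b}"
  have sub: "{x. \<not> good_batch n b d (arrival_path x) k}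
      \<subseteq> (\<Union>z\<in>?Z. Bq z) \<union> ((\<Union>i\<in>{1..n}. Br i) \<union> (\<Union>j\<in>{1..n}. Bc j))"
  proof
    fix x assume "x \<in> {x. \<not> good_batch n b d (arrival_path x) k}"
    then consider (q) i j u where "i \<in> {1..n}" "j \<in> {1..n}" "u < b - d"
        "\<not> (\<Sum>v<Suc u. round_robin n v i j) \<le> arrivals (arrival_path x) (k * b) (k * b + d + u) i j"
      | (r) i where "i \<in> {1..n}" "\<not> (\<Sum>j=1..n. arrivals (arrival_path x) (k * b) (k * b + b) i j) \<le> b - n"
      | (c) j where "j \<in> {1..n}" "\<not> (\<Sum>i=1..n. arrivals (arrival_path x) (k * b) (k * b + b) i j) \<le> b - n"
      unfolding good_batch_def by blast
    then show "x \<in> (\<Union>z\<in>?Z. Bq z) \<union> ((\<Union>i\<in>{1..n}. Br i) \<union> (\<Union>j\<in>{1..n}. Bc j))"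
    proof cases
      case q
      have "(\<Sum>i\<in>{i} \<times> {j} \<times> {k * b..<k * b + d + u}. x i) = arrivals (arrival_path x) (k * b) (k * b + d + u) i j"
        unfolding arrivals_def arrival_path_def
        by (rule sum.reindex_bij_witness[of _ "\<lambda>t. (i, j, t)" "\<lambda>(_, _, t). t"]) auto
      with q round_robin_count_le[of i n j "Suc u"] have "x \<in> Bq (i, j, u)" by (simp add: Bq_def)
      then show ?thesis using q by auto
    next
      case r
      have "(\<Sum>j=1..n. arrivals (arrival_path x) (k * b) (k * b + b) i j) = (\<Sum>i\<in>{i} \<times> {1..n} \<times> ?I. x i)"
        unfolding arrivals_def arrival_path_def sum.cartesian_product
        by (rule sum.reindex_bij_witness[of _ "\<lambda>(_, j, t). (j, t)" "\<lambda>(j, t). (i, j, t)"]) auto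
      with r have "x \<in> Br i" by (simp add: Br_def)
      then show ?thesis using r by blast
    next
      case c
      have "(\<Sum>i=1..n. arrivals (arrival_path x) (k * b) (k * b + b) i j) = (\<Sum>i\<in>{1..n} \<times> {j} \<times> ?I. x i)"
        unfolding arrivals_def arrival_path_def sum.cartesian_product
        by (rule sum.reindex_bij_witness[of _ "\<lambda>(i, _, t). (i, t)" "\<lambda>(i, t). (i, j, t)"]) auto
      with c have "x \<in> Bc j" by (simp add: Bc_def)
      then show ?thesis using c by blast
    qed
  qed
  have "?pr {x. \<not> good_batch n b d (arrival_path x) k}
      \<le> ?pr ((\<Union>z\<in>?Z. Bq z) \<union> ((\<Union>i\<in>{1..n}. Br i) \<union> (\<Union>j\<in>{1..n}. Bc j)))"
    by (intro measure_pmf.finite_measure_mono sub) auto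
  also have "\<dots> \<le> ?pr (\<Union>z\<in>?Z. Bq z) + (?pr (\<Union>i\<in>{1..n}. Br i) + ?pr (\<Union>j\<in>{1..n}. Bc j))"
    by (intro measure_Un_le[THEN order_trans] add_left_mono) auto
  also have "\<dots> \<le> (\<Sum>z\<in>?Z. ?pr (Bq z)) + ((\<Sum>i\<in>{1..n}. ?pr (Br i)) + (\<Sum>j\<in>{1..n}. ?pr (Bc j)))"
    by (intro add_mono measure_pmf.finite_measure_subadditive_finite) auto
  also have "\<dots> \<le> (\<Sum>z\<in>?Z. \<epsilon>) + ((\<Sum>i\<in>{1..n}. \<epsilon>) + (\<Sum>j\<in>{1..n}. \<epsilon>))"
    by (intro add_mono sum_mono q r c)
  also have "\<dots> = ((real n)\<^sup>2 * real b + 2 * real n) * \<epsilon>"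
    by (simp add: power2_eq_square algebra_simps)
  finally show ?thesis .
qed

end

subsection \<open>Choice of the parameters\<close>

text \<open>The factor \<open>640 = 16 * 40\<close> makes the overload bound
  \<open>f ^ (-40)\<close>. As \<open>b \<le> 1280 * f ^ 2 * L\<close>, the factor
  \<open>5120 = 4 * 1280\<close> yields \<open>4 * b / f \<le> d\<close>, and it more than suffices
  for the supply bound. The power \<open>40\<close> leaves \<open>p \<le> 1281 / f ^ 35\<close>, so
  every term containing \<open>p\<close> is bounded by a constant. The minimum keeps
  \<open>d \<le> b\<close> when \<open>f\<close> is not large compared with
  \<open>sqrt n\<close>.\<close>

lemma batch_parameters:
  fixes n :: nat and f :: real
  assumes n: "2 \<le> n" and f: "real n \<le> f"
  defines "L \<equiv> ln f"
  defines "b \<equiv> nat \<lceil>640 * f\<^sup>2 * L\<rceil>"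
  defines "d \<equiv> min (nat \<lceil>5120 * sqrt n * f * L\<rceil>) b"
  defines "\<epsilon> \<equiv> 1 / f ^ 40"
  defines "p \<equiv> ((real n)\<^sup>2 * real b + 2 * real n) * \<epsilon>"
  shows "n \<le> d" and "d \<le> b" and "2 * real n * f \<le> real b"
    and "exp (- real b / (16 * f\<^sup>2)) \<le> \<epsilon>"
    and "d < b \<Longrightarrow> 4 * real b / f \<le> real d" and "d < b \<Longrightarrow> 8 * real n \<le> real d"
    and "d < b \<Longrightarrow> exp (- (real d)\<^sup>2 / (16 * real n * real b)) \<le> \<epsilon>"
    and "0 \<le> p" and "12 * p * real b \<le> 1"
    and "12 * real n ^ 2 * p * real b ^ 2 + 2 * real n * real d + 2 * real n ^ 2 * real b * p
      \<le> 10500 * real n powr 1.5 * f * L"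
proof -
  have n2: "2 \<le> real n" using n by simp
  have f2: "2 \<le> f" using n2 f by simp
  have "2 / 3 \<le> ln (2::real)" by (rule ln2_ge_two_thirds)
  also have "\<dots> \<le> L" using f2 by (simp add: L_def)
  finally have L: "2 / 3 \<le> L" .
  have Lf: "L \<le> f" using ln_le_minus_one[of f] f2 by (simp add: L_def)
  have sn: "1 \<le> sqrt n" using n2 by simp
  have fL: "f * (2 / 3) \<le> f * L" using L f2 by (intro mult_left_mono) auto
  have ffL: "f\<^sup>2 * (2 / 3) \<le> f\<^sup>2 * L" using L by (intro mult_left_mono) auto
  have ff: "4 \<le> f\<^sup>2" using power_mono[of 2 f 2] f2 by simp
  have snfL: "f * L \<le> sqrt n * f * L"
    using mult_right_mono[OF sn, of "f * L"] L f2 by (simp add: mult.assoc)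
  have nf: "real n * f \<le> f\<^sup>2" using f f2 by (simp add: power2_eq_square mult_right_mono)
  have b1: "640 * f\<^sup>2 * L \<le> real b" and b2: "real b \<le> 640 * f\<^sup>2 * L + 1"
    using ffL ff unfolding b_def by linarith+
  have b3: "real b \<le> 1280 * f\<^sup>2 * L" using b2 ffL ff by linarith
  define d0 where "d0 = nat \<lceil>5120 * sqrt n * f * L\<rceil>"
  have d1: "5120 * (sqrt n * f * L) \<le> real d0" and d2: "real d0 \<le> 5120 * (sqrt n * f * L) + 1"
    using snfL fL f2 unfolding d0_def mult.assoc by linarith+
  have nd0: "8 * real n \<le> real d0" using d1 snfL fL f f2 by linarith
  have nb: "2 * real n * f \<le> real b" using b1 ffL nf ff by linarith
  show "2 * real n * f \<le> real b" by (rule nb)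
  have "real n * 2 \<le> real n * f" using f2 by (intro mult_left_mono) auto
  then have "real n \<le> real b" using nb n2 by linarith
  with nd0 show "n \<le> d" unfolding d_def d0_def[symmetric] by simp
  show "d \<le> b" by (simp add: d_def)
  have \<epsilon>: "exp (- (40 * L)) = \<epsilon>"
    using f2 exp_of_nat_mult[of 40 L] by (simp add: \<epsilon>_def L_def exp_minus inverse_eq_divide)
  have "0 < 16 * f\<^sup>2" "40 * L * (16 * f\<^sup>2) \<le> real b" using b1 ff f2 by (simp_all add: mult_ac)
  then have "40 * L \<le> real b / (16 * f\<^sup>2)" by (simp only: pos_le_divide_eq)
  then show "exp (- real b / (16 * f\<^sup>2)) \<le> \<epsilon>" unfolding \<epsilon>[symmetric] by simp
  have bpos: "0 < real b" using nb n2 f2 by (smt (verit) mult_pos_pos)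
  show "4 * real b / f \<le> real d" "8 * real n \<le> real d"
    "exp (- (real d)\<^sup>2 / (16 * real n * real b)) \<le> \<epsilon>" if "d < b"
  proof -
    have d: "d = d0" using that by (simp add: d_def d0_def min_def split: if_splits)
    show "8 * real n \<le> real d" using nd0 d by simp
    have "4 * real b / f \<le> 5120 * (f * L)"
      using b3 f2 by (simp add: field_simps power2_eq_square)
    also have "\<dots> \<le> real d" using snfL d1 d by linarith
    finally show "4 * real b / f \<le> real d" .
    have "(5120 * (sqrt n * f * L))\<^sup>2 \<le> (real d)\<^sup>2"
      using d1 d L f2 by (intro power_mono) auto
    then have d3: "26214400 * (real n * f\<^sup>2 * L\<^sup>2) \<le> (real d)\<^sup>2" by (simp add: power_mult_distrib)
    have "40 * L * (16 * real n * real b) \<le> 40 * L * (16 * real n * (1280 * f\<^sup>2 * L))"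
      using b3 L by (intro mult_left_mono) auto
    also have "\<dots> = 819200 * (real n * f\<^sup>2 * L\<^sup>2)" by (simp add: power2_eq_square)
    also have "\<dots> \<le> 26214400 * (real n * f\<^sup>2 * L\<^sup>2)" by (intro mult_right_mono) auto
    finally have "40 * L * (16 * real n * real b) \<le> (real d)\<^sup>2" using d3 by linarith
    then have "40 * L \<le> (real d)\<^sup>2 / (16 * real n * real b)" using bpos n2 by (simp add: pos_le_divide_eq)
    then show "exp (- (real d)\<^sup>2 / (16 * real n * real b)) \<le> \<epsilon>" unfolding \<epsilon>[symmetric] by simp
  qed
  have \<epsilon>0: "0 \<le> \<epsilon>" using f2 by (simp add: \<epsilon>_def)
  show p0: "0 \<le> p" unfolding p_def using \<epsilon>0 by simp
  have b4: "real b \<le> 1280 * f ^ 3"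
  proof -
    have "1280 * f\<^sup>2 * L \<le> 1280 * f\<^sup>2 * f" using Lf by (intro mult_left_mono) auto
    then show ?thesis using b3 by (simp add: power2_eq_square power3_eq_cube)
  qed
  have n_sq: "(real n)\<^sup>2 \<le> f\<^sup>2" using f by (intro power_mono) auto
  have n2b: "(real n)\<^sup>2 * real b \<le> 1280 * f ^ 5"
  proof -
    have "(real n)\<^sup>2 * real b \<le> f\<^sup>2 * (1280 * f ^ 3)" using n_sq b4 by (intro mult_mono) auto
    also have "\<dots> = 1280 * f ^ 5" using power_add[of f 2 3] by simp
    finally show ?thesis .
  qed
  have "f * 2 ^ 4 \<le> f * f ^ 4" using f2 by (intro mult_left_mono power_mono) auto
  then have "2 * f \<le> f ^ 5" using f2 by (simp add: power_Suc[symmetric] del: power_Suc)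
  then have "(real n)\<^sup>2 * real b + 2 * real n \<le> 1281 * f ^ 5" using n2b f by linarith
  then have "p \<le> 1281 * f ^ 5 * \<epsilon>" unfolding p_def using \<epsilon>0 by (rule mult_right_mono)
  also have "\<dots> = 1281 / f ^ 35"
    using f2 power_add[of f 5 35] by (simp add: \<epsilon>_def field_simps)
  finally have p1: "p \<le> 1281 / f ^ 35" .
  have pow: "2 ^ k \<le> f ^ k" for k using f2 by (intro power_mono) auto
  have pb: "p * real b \<le> 1281 * 1280 / f ^ 32"
  proof -
    have "p * real b \<le> 1281 / f ^ 35 * (1280 * f ^ 3)"
      using p1 b4 p0 f2 by (intro mult_mono) auto
    also have "\<dots> = 1281 * 1280 / f ^ 32"
      using f2 power_add[of f 3 32] by (simp add: field_simps)
    finally show ?thesis .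
  qed
  have "1281 * 1280 / f ^ 32 \<le> 1281 * 1280 / 2 ^ 32"
    using pow[of 32] f2 by (intro divide_left_mono) auto
  with pb show "12 * p * real b \<le> 1" by simp
  have e1: "12 * real n ^ 2 * p * real b ^ 2 \<le> 188"
  proof -
    have "12 * real n ^ 2 * p * real b ^ 2 = 12 * ((real n)\<^sup>2 * real b) * (p * real b)"
      by (simp add: power2_eq_square)
    also have "\<dots> \<le> 12 * (1280 * f ^ 5) * (1281 * 1280 / f ^ 32)"
      by (rule mult_mono[OF mult_left_mono[OF n2b] pb]) (use p0 f2 in auto)
    also have "\<dots> = 12 * 1280 * 1281 * 1280 / f ^ 27"
      using f2 power_add[of f 5 27] by (simp add: field_simps)
    also have "\<dots> \<le> 12 * 1280 * 1281 * 1280 / 2 ^ 27"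
      using pow[of 27] f2 by (intro divide_left_mono) auto
    finally show ?thesis by simp
  qed
  have e2: "2 * real n ^ 2 * real b * p \<le> 1"
  proof -
    have "2 * real n ^ 2 * real b * p = 2 * (real n)\<^sup>2 * (p * real b)" by simp
    also have "\<dots> \<le> 2 * f\<^sup>2 * (1281 * 1280 / f ^ 32)"
      using n_sq pb p0 f2 by (intro mult_mono) auto
    also have "\<dots> = 2 * 1281 * 1280 / f ^ 30"
      using f2 power_add[of f 2 30] by (simp add: field_simps)
    also have "\<dots> \<le> 2 * 1281 * 1280 / 2 ^ 30"
      using pow[of 30] f2 by (intro divide_left_mono) auto
    finally show ?thesis by simp
  qed
  have one: "1 \<le> sqrt n * f * L" using snfL fL f2 by linarith
  have "real d \<le> real d0" by (simp add: d_def d0_def)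
  then have "real d \<le> 5121 * (sqrt n * f * L)" using d2 one by linarith
  then have "2 * real n * real d \<le> 2 * real n * (5121 * (sqrt n * f * L))" by (intro mult_left_mono) auto
  then have e3: "2 * real n * real d \<le> 10242 * (real n * (sqrt n * f * L))" by simp
  \<comment> \<open>The main term is at least \<open>1\<close>, so the constants \<open>188\<close>
    and \<open>1\<close> fit between \<open>10242\<close> and \<open>10500\<close>.\<close>
  have "1 * 1 \<le> real n * (sqrt n * f * L)" using n2 one by (intro mult_mono) auto
  with e1 e2 e3 have "12 * real n ^ 2 * p * real b ^ 2 + 2 * real n * real d + 2 * real n ^ 2 * real b * p
      \<le> 10500 * (real n * (sqrt n * f * L))" by linarith
  moreover have "real n powr 1.5 = real n * sqrt n"
    using n2 powr_add[of "real n" 1 "1/2"] by (simp add: powr_half_sqrt)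
  ultimately show "12 * real n ^ 2 * p * real b ^ 2 + 2 * real n * real d + 2 * real n ^ 2 * real b * p
      \<le> 10500 * real n powr 1.5 * f * L" by (simp add: mult.assoc)
qed

section \<open>The two policies and the final bound\<close>

lemma batching_policy_bound:
  fixes n :: nat and f :: real
  assumes n: "2 \<le> n" and f: "real n \<le> f"
    and A: "bernoulli_arrivals n (1 - 1 / f) M A" and \<tau>: "1 \<le> \<tau>"
  defines "b \<equiv> nat \<lceil>640 * f\<^sup>2 * ln f\<rceil>"
  defines "d \<equiv> min (nat \<lceil>5120 * sqrt n * f * ln f\<rceil>) b"
  shows "integrable M (\<lambda>\<omega>. real (queue n (arrival_policy (batch_schedule n b d)) (\<lambda>i j \<tau>. A i j \<tau> \<omega>) \<tau> i j))"
    and "(\<Sum>i=1..n. \<Sum>j=1..n. \<integral>\<omega>. real (queue n (arrival_policy (batch_schedule n b d)) (\<lambda>i j \<tau>. A i j \<tau> \<omega>) \<tau> i j) \<partial>M)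
      \<le> 10500 * real n powr 1.5 * f * ln f"
proof -
  define \<epsilon> where "\<epsilon> = 1 / f ^ 40"
  define p where "p = ((real n)\<^sup>2 * real b + 2 * real n) * \<epsilon>"
  \<comment> \<open>The horizon extends past \<open>\<tau>\<close> so that the batch in service is
    complete within it.\<close>
  define H where "H = \<tau> + 2 * b"
  note par = batch_parameters[OF n f, folded b_def, folded d_def, folded \<epsilon>_def, folded p_def]
  have n1: "1 \<le> n" "1 \<le> real n" using n by auto
  have f1: "1 \<le> f" using f n1 by linarith
  have q: "0 \<le> (1 - 1 / f) / real n" "(1 - 1 / f) / real n \<le> 1 / real n"
    using f1 by (auto intro: divide_right_mono)
  moreover have "1 / real n \<le> 1" using n1 by simp
  ultimately have q1: "(1 - 1 / f) / real n \<le> 1" by linarith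
  interpret C: batch_concentration n H f b d \<epsilon>
    by unfold_locales (use par n1 f1 q q1 in simp_all)
  interpret S: switch_field n H "(1 - 1 / f) / real n" b d p
    by unfold_locales (use par n1 f1 q q1 C.prob_bad_batch in \<open>simp_all add: p_def\<close>)
  have b: "b > 0" using par(1,2) n by linarith
  have H: "0 < H" "\<tau> \<le> H" "\<tau> - 1 + 2 * b \<le> H" using \<tau> by (auto simp: H_def)
  note E = arrival_policy_expectation[OF A n1(1) causal_batch_schedule[OF b] H(1,2)]
  show "integrable M (\<lambda>\<omega>. real (queue n (arrival_policy (batch_schedule n b d)) (\<lambda>i j \<tau>. A i j \<tau> \<omega>) \<tau> i j))"
    by (rule E)
  show "(\<Sum>i=1..n. \<Sum>j=1..n. \<integral>\<omega>. real (queue n (arrival_policy (batch_schedule n b d)) (\<lambda>i j \<tau>. A i j \<tau> \<omega>) \<tau> i j) \<partial>M)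
      \<le> 10500 * real n powr 1.5 * f * ln f"
    unfolding E(2) C.field.P_def[symmetric] using S.expectation_total_queue[OF H(3)] par(10) by linarith
qed

text \<open>For \<open>n = 1\<close> the bound must vanish at \<open>f = 1\<close>, where
  \<open>ln f = 0\<close>, so no additive constant is affordable. Serving in every slot leaves only
  the last arrival, whose mean \<open>1 - 1 / f\<close> is at most \<open>ln f\<close>.\<close>

lemma single_queue_bound:
  fixes f :: real
  assumes f: "1 \<le> f" and A: "bernoulli_arrivals 1 (1 - 1 / f) M A" and \<tau>: "1 \<le> \<tau>"
  shows "integrable M (\<lambda>\<omega>. real (queue 1 (arrival_policy (\<lambda>a. round_robin 1)) (\<lambda>i j \<tau>. A i j \<tau> \<omega>) \<tau> i j))"
    and "(\<Sum>i=1..1. \<Sum>j=1..1. \<integral>\<omega>. real (queue 1 (arrival_policy (\<lambda>a. round_robin 1)) (\<lambda>i j \<tau>. A i j \<tau> \<omega>) \<tau> i j) \<partial>M)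
      \<le> f * ln f"
proof -
  define q where "q = (1 - 1 / f) / real 1"
  interpret S: bernoulli_field "ports_slots 1 \<tau>" q
    by unfold_locales (use f in \<open>simp_all add: q_def\<close>)
  have S: "causal (\<lambda>a. round_robin 1)" by (simp add: causal_def)
  have \<tau>0: "0 < \<tau>" using \<tau> by simp
  note E = arrival_policy_expectation[OF A order_refl S \<tau>0 order_refl, folded q_def, folded S.P_def]
  show "integrable M (\<lambda>\<omega>. real (queue 1 (arrival_policy (\<lambda>a. round_robin 1)) (\<lambda>i j \<tau>. A i j \<tau> \<omega>) \<tau> i j))"
    by (rule E)
  let ?q = "\<lambda>x t. queues (round_robin 1) (arrival_path x) t 1 1"
  have rr: "round_robin 1 u 1 1 = 1" for u
    using round_robin_row_sum[of 1 1 u] by simp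
  have le: "?q x t \<le> 1" if "x \<in> set_pmf S.P" for x t
  proof (induction t)
    case (Suc t)
    have "arrival_path x t 1 1 \<le> 1" using S.set_P_le_1[OF that] by (simp add: arrival_path_def)
    then show ?case using Suc by (simp add: rr)
  qed simp
  have "measure_pmf.expectation S.P (\<lambda>x. real (?q x (\<tau> - 1))) \<le> q"
  proof (cases "\<tau> - 1")
    case 0
    then show ?thesis using S.q by simp
  next
    case (Suc t)
    have "measure_pmf.expectation S.P (\<lambda>x. real (?q x (\<tau> - 1))) \<le> measure_pmf.expectation S.P (\<lambda>x. real (x (1, 1, t)))"
      using le by (intro S.expectation_mono) (simp add: Suc rr arrival_path_def)
    also have "\<dots> = q" using Suc by (intro S.expectation_coordinate) auto
    finally show ?thesis .
  qed
  also have "q \<le> ln f"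
    using ln_le_minus_one[of "1 / f"] f by (simp add: q_def ln_div)
  also have "\<dots> \<le> f * ln f" using f mult_right_mono[of 1 f "ln f"] by simp
  finally show "(\<Sum>i=1..1. \<Sum>j=1..1. \<integral>\<omega>. real (queue 1 (arrival_policy (\<lambda>a. round_robin 1)) (\<lambda>i j \<tau>. A i j \<tau> \<omega>) \<tau> i j) \<partial>M)
      \<le> f * ln f"
    unfolding E(2) by simp
qed

text \<open>The policy is fixed before the probability space, the arrivals and the slot.
  Integrability is asserted separately because the integral of a nonintegrable function is
  \<open>0\<close> by convention.\<close>

theorem theorem3p1:
  fixes f :: "nat \<Rightarrow> real"
  assumes "\<forall>n\<ge>1. f n \<ge> real n"
  shows "\<exists>c::real. \<forall>n\<ge>1. \<exists>\<pi>. scheduling_policy n \<pi> \<and>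
    (\<forall>(M :: 'a measure) A. bernoulli_arrivals n (1 - 1 / f n) M A \<longrightarrow>
      (\<forall>\<tau>\<ge>1.
        (\<forall>i\<in>{1..n}. \<forall>j\<in>{1..n}.
          integrable M (\<lambda>\<omega>. real (queue n \<pi> (\<lambda>i j \<tau>. A i j \<tau> \<omega>) \<tau> i j))) \<and>
        (\<Sum>i=1..n. \<Sum>j=1..n.
          prob_space.expectation M (\<lambda>\<omega>. real (queue n \<pi> (\<lambda>i j \<tau>. A i j \<tau> \<omega>) \<tau> i j)))
        \<le> c * real n powr 1.5 * f n * ln (f n)))"
proof (rule exI[of _ 10500], intro allI impI)
  fix n :: nat assume n: "1 \<le> n"
  then have f: "real n \<le> f n" using assms by blast
  show "\<exists>\<pi>. scheduling_policy n \<pi> \<and>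
    (\<forall>(M :: 'a measure) A. bernoulli_arrivals n (1 - 1 / f n) M A \<longrightarrow>
      (\<forall>\<tau>\<ge>1.
        (\<forall>i\<in>{1..n}. \<forall>j\<in>{1..n}.
          integrable M (\<lambda>\<omega>. real (queue n \<pi> (\<lambda>i j \<tau>. A i j \<tau> \<omega>) \<tau> i j))) \<and>
        (\<Sum>i=1..n. \<Sum>j=1..n.
          prob_space.expectation M (\<lambda>\<omega>. real (queue n \<pi> (\<lambda>i j \<tau>. A i j \<tau> \<omega>) \<tau> i j)))
        \<le> 10500 * real n powr 1.5 * f n * ln (f n)))"
  proof (cases "n = 1")
    case True
    have f1: "1 \<le> f 1" using f True by simp
    have "scheduling_policy 1 (arrival_policy (\<lambda>a. round_robin 1))"
      by (simp add: scheduling_policy_def arrival_policy_def round_robin_in_schedules)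
    moreover have B: "f 1 * ln (f 1) \<le> 10500 * real 1 powr 1.5 * f 1 * ln (f 1)"
      using f1 by simp
    note single_queue_bound(1)[OF f1] order_trans[OF single_queue_bound(2)[OF f1] B]
    ultimately show ?thesis unfolding True by blast
  next
    case False
    then have n2: "2 \<le> n" using n by simp
    have "scheduling_policy n (arrival_policy (batch_schedule n b d))" for b d
      using n by (simp add: scheduling_policy_def arrival_policy_def batch_schedule_in_schedules)
    then show ?thesis using batching_policy_bound[OF n2 f] by blast
  qed
qed

end
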